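(* Let $\mathcal{G}$ be the set of points $s\in\mathbb{C}$ with $|s-1|>2\pi e$ and $$\frac{\pi}{2}\le\arg(s-1)\le\frac{\pi}{2}+2\arctan\sqrt{\log\frac{|s-1|}{2\pi}}.$$ For $s\in\mathcal{G}$ with $\sigma:=\operatorname{Re}(s)<0$ and $s\to\infty$, $$\mathcal{R}(s)=\chi(s)\,O(\log|s|).$$
   Context: Riemann's auxiliary function is the entire function $$\mathcal{R}(s)=\int_{0\swarrow1}\frac{x^{-s}e^{\pi i x^2}}{e^{\pi i x}-e^{-\pi i x}}\,dx,$$ where the path is a straight line of direction $e^{-3\pi i/4}$ (running from the upper right to the lower left) crossing the real axis at a point strictly between $0$ and $1$, and $x^{-s}=\exp(-s\log x)$ with the principal logarithm. $\chi(s)=\pi^{s-\frac12}\Gamma(\frac{1-s}{2})/\Gamma(\frac{s}{2})$, so that $\zeta(s)=\chi(s)\zeta(1-s)$. Here $\arg(s-1)$ is taken in $(0,2\pi)$. *)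

theory Defs
  imports "HOL-Analysis.Analysis" "HOL-Library.Landau_Symbols"
begin

text \<open>
  The path is \<open>x(t) = c + t e\<^bsup>-3\<pi>i/4\<^esup>\<close> with \<open>t\<close> running over the whole real line, so it comes
  from the upper right, crosses the real axis at \<open>c\<close> and leaves to the lower left; the trailing
  factor is \<open>x'(t)\<close>.  For \<open>0 < c < 1\<close> the path avoids the branch cut of \<open>Ln\<close> and the zeros of the
  denominator, and since \<open>Re (\<pi> i x(t)\<^sup>2) = - \<pi> t\<^sup>2 + O(\<bar>t\<bar>)\<close> the integral converges absolutely.
  By Cauchy's theorem its value does not depend on \<open>c \<in> (0,1)\<close>; the crossing point is kept as a
  parameter instead of choosing one.
\<close>

definition riemann_path :: "real \<Rightarrow> real \<Rightarrow> complex" where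
  "riemann_path c t = of_real c + of_real t * cis (- (3 * pi / 4))"

definition riemann_aux_integrand :: "complex \<Rightarrow> complex \<Rightarrow> complex" where
  "riemann_aux_integrand s x =
     exp (- s * Ln x) * exp (of_real pi * \<i> * x\<^sup>2) /
     (exp (of_real pi * \<i> * x) - exp (- (of_real pi * \<i> * x)))"

definition riemann_aux :: "real \<Rightarrow> complex \<Rightarrow> complex" where
  "riemann_aux c s =
     (LINT t|lborel. riemann_aux_integrand s (riemann_path c t) * cis (- (3 * pi / 4)))"

text \<open>
  At the poles \<open>s = 0, -2, -4, \<dots>\<close> of \<open>Gamma (s / 2)\<close> the conventions \<open>Gamma = 0\<close> at poles and
  \<open>z / 0 = 0\<close> give the value \<open>0\<close>, which is the value of the analytic continuation of \<open>\<chi>\<close> there.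
  At the poles \<open>s = 1, 3, 5, \<dots>\<close> of \<open>\<chi>\<close> the value \<open>0\<close> is meaningless.
\<close>

definition zeta_chi :: "complex \<Rightarrow> complex" where
  "zeta_chi s = of_real pi powr (s - 1 / 2) * Gamma ((1 - s) / 2) / Gamma (s / 2)"

text \<open>
  \<open>Arg2pi\<close> takes values in \<open>[0, 2\<pi>)\<close>; the value \<open>0\<close>, attained only on the nonnegative reals,
  is excluded below by the lower bound \<open>\<pi>/2\<close>.
\<close>

definition region_G :: "complex set" where
  "region_G = {s. cmod (s - 1) > 2 * pi * exp 1 \<and>
                  pi / 2 \<le> Arg2pi (s - 1) \<and>
                  Arg2pi (s - 1) \<le> pi / 2 + 2 * arctan (sqrt (ln (cmod (s - 1) / (2 * pi))))}"

end

theory Submission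
  imports Defs "HOL-Complex_Analysis.Complex_Analysis" "HOL-Real_Asymp.Real_Asymp"
    "HOL-Probability.Sinc_Integral"
begin

text \<open>
  Put \<open>w = 1 - s\<close>, so \<open>Re w > 1\<close>.  The integrand satisfies \<open>F (- u) = - e\<^bsup>\<pi> i s\<^esup> F u\<close> on the upper half
  plane and is integrable at \<open>0\<close>, so the path may be collapsed onto a line through \<open>0\<close>, which gives
  \<open>R(s) = (e\<^bsup>\<pi> i s\<^esup> - 1) M\<close> with \<open>M\<close> the integral of \<open>F\<close> along any ray in the open first quadrant.
  By the duplication and reflection formulas \<open>\<chi>(s)\<close> contains the same factor \<open>e\<^bsup>\<pi> i s\<^esup> - 1\<close>, so the
  zeros of \<open>\<chi>\<close> cancel and the claim becomes
  \<open>\<bar>M\<bar> = O(log \<bar>w\<bar>) \<bar>\<Gamma>(w)\<bar> (2 \<pi>)\<^bsup>- Re w\<^esup> e\<^bsup>- \<pi> Im w / 2\<^esup>\<close>.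
  The right-hand side is bounded below by Stirling's formula.  For \<open>M\<close> take the ray through the saddle
  point of \<open>u\<^sup>w e\<^bsup>\<pi> i u\<^sup>2\<^esup>\<close>, where the modulus of that function is greatest on the ray.  With
  \<open>L = log (\<bar>w\<bar> / 2 \<pi>)\<close> and \<open>\<alpha>\<close> the angle of the ray, the two sides are about
  \<open>exp (Re w (L - 1) / 2 - \<alpha> Im w)\<close> and \<open>exp (Re w (L - 1) - 2 \<alpha> Im w)\<close>; for \<open>Im w < 0\<close> this suffices,
  and for \<open>Im w \<ge> 0\<close> the region gives \<open>Im w \<le> Re w sqrt L / 2\<close>, so that \<open>Re w (L - 1)\<close> dominates.
\<close>

subsection \<open>A Stirling lower bound for the complex Gamma function\<close>

text \<open>The corrected trapezoidal error \<open>e h\<close> over [x, x + h] vanishes at 0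
  together with its derivative \<open>e1\<close>, and \<open>e1\<close> has the nonnegative
  derivative \<open>h * (B - m2 (x + h)) / 2\<close>. Monotonicity applied twice gives
  \<open>e 1 >= 0\<close>.\<close>

lemma trapezoid_lower:
  fixes M m m1 m2 :: "real \<Rightarrow> real"
  assumes M: "\<And>v. x \<le> v \<Longrightarrow> (M has_real_derivative m v) (at v)"
    and m: "\<And>v. x \<le> v \<Longrightarrow> (m has_real_derivative m1 v) (at v)"
    and m1: "\<And>v. x \<le> v \<Longrightarrow> (m1 has_real_derivative m2 v) (at v)"
    and m2: "\<And>v. x \<le> v \<Longrightarrow> m2 v \<le> B"
  shows "(m x + m (x + 1)) / 2 - B / 12 \<le> M (x + 1) - M x"
proof -
  define e where "e = (\<lambda>h. M (x + h) - M x - h * (m x + m (x + h)) / 2 + B * h ^ 3 / 12)"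
  define e1 where "e1 = (\<lambda>h. (m (x + h) - m x) / 2 - h * m1 (x + h) / 2 + B * h\<^sup>2 / 4)"
  have de: "(e has_real_derivative e1 h) (at h)" if "0 \<le> h" for h
    unfolding e_def e1_def using that
    by (auto intro!: derivative_eq_intros DERIV_chain2[OF M] DERIV_chain2[OF m]
        simp: field_simps power2_eq_square)
  have de1: "(e1 has_real_derivative h * (B - m2 (x + h)) / 2) (at h)" if "0 \<le> h" for h
    unfolding e1_def using that
    by (auto intro!: derivative_eq_intros DERIV_chain2[OF m] DERIV_chain2[OF m1]
        simp: field_simps power2_eq_square)
  have e1: "0 \<le> e1 h" if "0 \<le> h" for h
  proof -
    have "e1 0 \<le> e1 h"
      by (rule DERIV_nonneg_imp_nondecreasing[OF that])
        (use de1 m2 in \<open>force intro!: mult_nonneg_nonneg\<close>)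
    then show ?thesis by (simp add: e1_def)
  qed
  have "e 0 \<le> e 1"
    by (rule DERIV_nonneg_imp_nondecreasing) (use de e1 in force)+
  then show ?thesis by (simp add: e_def algebra_simps)
qed

text \<open>The real part of the Stirling approximation \<open>(w - 1/2) Ln w - w\<close> at \<open>w = x + i y\<close>.\<close>

definition stirling_re :: "real \<Rightarrow> real \<Rightarrow> real" where
  "stirling_re x y = (x - 1/2) * ln (x\<^sup>2 + y\<^sup>2) / 2 - y * arctan (y / x) - x"

text \<open>
  The correction \<open>- 1 / x\<close> absorbs the trapezoidal error, so that \<open>ln \<bar>\<Gamma>(w + n)\<bar>\<close> minus the corrected
  approximation at \<open>w + n\<close> decreases in \<open>n\<close>, and a lower bound at \<open>n = 0\<close> follows from the limit.
\<close>

lemma stirling_re_step: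
  assumes x: "1 \<le> x"
  shows "ln (x\<^sup>2 + y\<^sup>2) / 2 \<le> (stirling_re (x + 1) y - 1 / (x + 1)) - (stirling_re x y - 1 / x)"
proof -
  \<comment> \<open>\<open>M\<close> is a primitive of \<open>m\<close>, and \<open>m v\<close> is
    ln |v + i y|. Subtracting half of \<open>m\<close> from \<open>M\<close> turns the symmetric
    mean of the trapezoidal rule into the left endpoint value \<open>m x\<close>.\<close>
  define M where "M = (\<lambda>v. v * ln (v\<^sup>2 + y\<^sup>2) / 2 - y * arctan (y / v) - v)"
  define m where "m = (\<lambda>v. ln (v\<^sup>2 + y\<^sup>2) / 2)"
  have pos: "v\<^sup>2 + y\<^sup>2 > 0" if "x \<le> v" for v
    using that x by (intro add_pos_nonneg) auto
  have S: "stirling_re v y = M v - m v / 2" for v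
    by (simp add: stirling_re_def M_def m_def field_simps)
  have "(m x + m (x + 1)) / 2 - (1 / x\<^sup>2) / 12 \<le> M (x + 1) - M x"
  proof (rule trapezoid_lower)
    fix v assume v: "x \<le> v"
    have v0: "v \<noteq> 0" "v > 0" using v x by auto
    have arc: "((\<lambda>v. arctan (y / v)) has_real_derivative - y / (v\<^sup>2 + y\<^sup>2)) (at v)"
      using v0 pos[OF v]
      by (auto intro!: derivative_eq_intros simp: divide_simps power2_eq_square)
    have ln: "((\<lambda>v. ln (v\<^sup>2 + y\<^sup>2)) has_real_derivative 2 * (v / (v\<^sup>2 + y\<^sup>2))) (at v)"
      using pos[OF v] by (auto intro!: derivative_eq_intros)
    have "((\<lambda>v. v * ln (v\<^sup>2 + y\<^sup>2) / 2) has_real_derivative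
        m v + v * (v / (v\<^sup>2 + y\<^sup>2))) (at v)"
    proof (rule DERIV_cong[OF DERIV_cdivide[OF DERIV_mult[OF DERIV_ident ln]]])
      have "(1 * ln (v\<^sup>2 + y\<^sup>2) + 2 * t * v) / 2 = m v + v * t" for t
        by (simp add: m_def field_simps)
      then show "(1 * ln (v\<^sup>2 + y\<^sup>2) + 2 * (v / (v\<^sup>2 + y\<^sup>2)) * v) / 2 = m v + v * (v / (v\<^sup>2 + y\<^sup>2))" .
    qed
    moreover have "((\<lambda>v. y * arctan (y / v) + v) has_real_derivative
        y * (- y / (v\<^sup>2 + y\<^sup>2)) + 1) (at v)"
      by (rule DERIV_add DERIV_cmult arc DERIV_ident)+
    ultimately have "((\<lambda>v. v * ln (v\<^sup>2 + y\<^sup>2) / 2 - (y * arctan (y / v) + v)) has_real_derivative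
        m v + v * (v / (v\<^sup>2 + y\<^sup>2)) - (y * (- y / (v\<^sup>2 + y\<^sup>2)) + 1)) (at v)"
      by (rule DERIV_diff)
    moreover have "v * (v / D) + y * (y / D) = (v\<^sup>2 + y\<^sup>2) / D" for D
      by (simp add: add_divide_distrib power2_eq_square)
    from this[of "v\<^sup>2 + y\<^sup>2"] have "v * (v / (v\<^sup>2 + y\<^sup>2)) + y * (y / (v\<^sup>2 + y\<^sup>2)) = 1"
      using pos[OF v] by (metis divide_self less_irrefl)
    ultimately show "(M has_real_derivative m v) (at v)"
      by (simp add: M_def diff_diff_eq algebra_simps)
    have "2 * t / 2 = t" for t :: real by simp
    then show "(m has_real_derivative v / (v\<^sup>2 + y\<^sup>2)) (at v)"
      unfolding m_def by (rule DERIV_cong[OF DERIV_cdivide[OF ln]])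
    show "((\<lambda>v. v / (v\<^sup>2 + y\<^sup>2)) has_real_derivative (y\<^sup>2 - v\<^sup>2) / (v\<^sup>2 + y\<^sup>2)\<^sup>2) (at v)"
      using pos[OF v]
      by (auto intro!: derivative_eq_intros simp: power2_eq_square field_simps)
    have "(y\<^sup>2 - v\<^sup>2) / (v\<^sup>2 + y\<^sup>2)\<^sup>2 \<le> (v\<^sup>2 + y\<^sup>2) / (v\<^sup>2 + y\<^sup>2)\<^sup>2"
      by (intro divide_right_mono) auto
    also have "\<dots> = 1 / (v\<^sup>2 + y\<^sup>2)"
      using pos[OF v] by (simp add: power2_eq_square)
    also have "\<dots> \<le> 1 / x\<^sup>2"
      using v x by (intro divide_left_mono) (auto intro!: add_increasing2 power_mono mult_pos_pos pos)
    finally show "(y\<^sup>2 - v\<^sup>2) / (v\<^sup>2 + y\<^sup>2)\<^sup>2 \<le> 1 / x\<^sup>2" .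
  qed
  \<comment> \<open>The trapezoidal error is absorbed in a telescoping term: 1 / x - 1 / (x + 1) = 1
    / (x (x + 1)), and x + 1 <= 12 x because x >= 1.\<close>
  moreover have "1 / x\<^sup>2 / 12 \<le> 1 / x - 1 / (x + 1)"
  proof -
    have "1 / x - 1 / (x + 1) = 1 / (x * (x + 1))" using x by (simp add: field_simps)
    moreover have "x * 1 \<le> x * x" using x by (intro mult_left_mono) auto
    hence "x * (x + 1) \<le> x\<^sup>2 * 12" using x by (simp add: power2_eq_square algebra_simps)
    ultimately show ?thesis using x by (simp add: frac_le)
  qed
  moreover have "p \<le> (D2 - q / 2 - a) - (D1 - p / 2 - b)"
    if "(p + q) / 2 - e \<le> D2 - D1" "e \<le> b - a" for p q e D1 D2 a b :: real
    using that by argo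
  ultimately have "m x \<le> (stirling_re (x + 1) y - 1 / (x + 1)) - (stirling_re x y - 1 / x)"
    unfolding S by blast
  then show ?thesis by (simp add: m_def)
qed

text \<open>Passing from n to N = n + 1 requires that the integral of ln over [N - 1/2, N + 1/2] be
  at most ln N: the midpoint inequality for the concave logarithm.\<close>

lemma ln_fact_lower: "(real n + 1/2) * ln (real n + 1/2) - real n \<le> ln (fact n)"
proof (induction n)
  case (Suc n)
  define N where "N = real (Suc n)"
  have N: "N \<ge> 1" by (simp add: N_def)
  \<comment> \<open>\<open>f h\<close> is the integral of ln over [N - h, N + h] minus
    \<open>2 * h * ln N\<close>. Its derivative is ln ((N + h) (N - h)) - 2 ln N, hence
    nonpositive.\<close>
  define f where "f = (\<lambda>h. (N + h) * ln (N + h) - (N - h) * ln (N - h) - 2 * h - 2 * h * ln N)"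
  have "f (1/2) \<le> f 0"
  proof (rule DERIV_nonpos_imp_nonincreasing[of 0 "1/2" f])
    fix h :: real assume h: "0 \<le> h" "h \<le> 1/2"
    have "((\<lambda>h. (N + h) * ln (N + h)) has_real_derivative ln (N + h) + 1) (at h)"
      "((\<lambda>h. (N - h) * ln (N - h)) has_real_derivative - ln (N - h) - 1) (at h)"
      using h N by (auto intro!: derivative_eq_intros)
    note d = DERIV_diff[OF this]
    have "((\<lambda>h. 2 * h + 2 * h * ln N) has_real_derivative 2 + 2 * ln N) (at h)"
      by (auto intro!: derivative_eq_intros)
    from DERIV_diff[OF d this]
    have "(f has_real_derivative ln (N + h) + ln (N - h) - 2 * ln N) (at h)"
      by (simp add: f_def algebra_simps)
    moreover have "ln ((N + h) * (N - h)) \<le> ln (N * N)"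
    proof (rule iffD2[OF ln_le_cancel_iff])
      show "0 < N * N" using N by simp
      show "0 < (N + h) * (N - h)" using h N by (intro mult_pos_pos) auto
      show "(N + h) * (N - h) \<le> N * N" by (simp add: algebra_simps)
    qed
    hence "ln (N + h) + ln (N - h) - 2 * ln N \<le> 0"
      using h N by (simp add: ln_mult)
    ultimately show "\<exists>D. (f has_real_derivative D) (at h) \<and> D \<le> 0" by blast
  qed simp
  then have "(N + 1/2) * ln (N + 1/2) - (N - 1/2) * ln (N - 1/2) - 1 \<le> ln N"
    by (simp add: f_def)
  moreover have "ln (fact (Suc n) :: real) = ln N + ln (fact n)"
    by (simp add: N_def ln_mult)
  ultimately show ?case using Suc by (simp add: N_def add_ac)
qed simp

text \<open>Since \<open>a\<close> decreases, \<open>a 0\<close> is at least the limit of any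
  sequence \<open>b n\<close> below \<open>a (Suc n)\<close>. The Gauss product
  \<open>Gamma_series\<close> supplies such a sequence with limit 1/2; the correction costs 1 / x <=
  1, so the constant - 1 leaves room to spare.\<close>

lemma ln_norm_Gamma_ge:
  fixes w :: complex
  assumes w: "1 \<le> Re w"
  shows "stirling_re (Re w) (Im w) - 1 \<le> ln (norm (Gamma w))"
proof -
  define x y where "x = Re w" and "y = Im w"
  have x: "1 \<le> x" using w by (simp add: x_def)
  define U where "U = (\<lambda>v. stirling_re v y - 1 / v)"
  define a where "a = (\<lambda>n. ln (norm (Gamma (w + of_nat n))) - U (x + real n))"
  have pos: "w + of_nat n \<notin> \<int>\<^sub>\<le>\<^sub>0" for n
    using w by (auto elim!: nonpos_Ints_cases simp: complex_eq_iff)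
  have nz: "Gamma (w + of_nat n) \<noteq> 0" for n
    using pos[of n] by (simp add: Gamma_eq_zero_iff)
  have "decseq a"
  proof (rule decseq_SucI)
    fix n
    have wn: "w + of_nat n \<noteq> 0" using pos[of n] by auto
    have "Gamma (w + of_nat (Suc n)) = (w + of_nat n) * Gamma (w + of_nat n)"
      using Gamma_plus1[of "w + of_nat n"] pos[of n] by (auto simp: add_ac)
    then have "ln (norm (Gamma (w + of_nat (Suc n)))) =
        ln (norm (w + of_nat n)) + ln (norm (Gamma (w + of_nat n)))"
      using wn nz by (simp add: norm_mult ln_mult)
    also have "ln (norm (w + of_nat n)) = ln ((x + real n)\<^sup>2 + y\<^sup>2) / 2"
      using wn by (simp add: cmod_def x_def y_def ln_sqrt add_pos_nonneg)
    also have "\<dots> \<le> U (x + real n + 1) - U (x + real n)"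
      unfolding U_def by (rule stirling_re_step) (use x in simp)
    finally show "a (Suc n) \<le> a n" by (simp add: a_def add_ac)
  qed
  \<comment> \<open>A lower estimate for \<open>a (Suc n)\<close> in three groups. The first tends
    to 0 by the Gauss product; the second is the part free of \<open>y\<close>, with ln (n!)
    replaced through \<open>ln_fact_lower\<close>; the third collects the terms in \<open>y\<close>
    and the correction, and tends to 0.\<close>
  define b where "b = (\<lambda>n. (ln (norm (Gamma w)) - ln (norm (Gamma_series w n))) +
      ((real n + 1/2) * ln (real n + 1/2) - real n + x * ln (real n)
        - ((x + real n + 1/2) * ln (x + real n + 1) - (x + real n + 1))) +
      (y * arctan (y / (x + real n + 1)) + 1 / (x + real n + 1) - y\<^sup>2 / (2 * (x + real n + 1))))"
  have "(\<lambda>n. ln (norm (Gamma w)) - ln (norm (Gamma_series w n))) \<longlonglongrightarrow>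
      ln (norm (Gamma w)) - ln (norm (Gamma w))"
    using nz[of 0] by (intro tendsto_intros) auto
  moreover have "(\<lambda>n. (real n + 1/2) * ln (real n + 1/2) - real n + x * ln (real n)
      - ((x + real n + 1/2) * ln (x + real n + 1) - (x + real n + 1))) \<longlonglongrightarrow> 1/2"
    by real_asymp
  moreover have "(\<lambda>n. y * arctan (y / (x + real n + 1)) + 1 / (x + real n + 1)
      - y\<^sup>2 / (2 * (x + real n + 1))) \<longlonglongrightarrow> y * arctan 0 + 0 - 0"
    by (intro tendsto_intros; real_asymp)
  ultimately have "b \<longlonglongrightarrow> (ln (norm (Gamma w)) - ln (norm (Gamma w))) + 1/2 + (y * arctan 0 + 0 - 0)"
    unfolding b_def by (intro tendsto_add)
  then have "b \<longlonglongrightarrow> 1/2" by simp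
  moreover have "eventually (\<lambda>n. b n \<le> a 0) sequentially"
    using eventually_gt_at_top[of 0]
  proof eventually_elim
    case (elim n)
    have ph: "pochhammer w (n + 1) \<noteq> 0"
      using pos[of 0] by (auto simp: pochhammer_eq_0_iff)
    have "Gamma (w + of_nat (Suc n)) = Gamma w * pochhammer w (n + 1)"
      using pochhammer_Gamma[of w "n + 1"] pos[of 0] nz[of 0] by (simp add: field_simps)
    moreover have "ln (norm (Gamma_series w n)) =
        ln (fact n) + x * ln (real n) - ln (norm (pochhammer w (n + 1)))"
      using ph by (simp add: Gamma_series_def norm_mult norm_divide ln_mult ln_div x_def
          del: pochhammer_Suc)
    ultimately have *: "ln (norm (Gamma (w + of_nat (Suc n)))) = ln (norm (Gamma w)) -
        ln (norm (Gamma_series w n)) + ln (fact n) + x * ln (real n)"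
      using ph nz[of 0] by (simp add: norm_mult ln_mult)
    define v where "v = x + real n + 1"
    have v: "v \<ge> 1" using x by (simp add: v_def)
    \<comment> \<open>Factoring out v^2 and using ln (1 + t) <= t costs only y^2 / (2 v), which
      disappears as n grows.\<close>
    have "v\<^sup>2 + y\<^sup>2 = v\<^sup>2 * (1 + y\<^sup>2 / v\<^sup>2)" using v by (simp add: field_simps)
    moreover have "1 + y\<^sup>2 / v\<^sup>2 > 0" by (intro add_pos_nonneg) auto
    ultimately have "ln (v\<^sup>2 + y\<^sup>2) = ln (v\<^sup>2) + ln (1 + y\<^sup>2 / v\<^sup>2)"
      using v by (simp add: ln_mult)
    also have "\<dots> \<le> 2 * ln v + y\<^sup>2 / v\<^sup>2"
      using v by (intro add_mono ln_add_one_self_le_self) (auto simp: ln_realpow)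
    finally have "(v - 1/2) * ln (v\<^sup>2 + y\<^sup>2) / 2 \<le> (v - 1/2) * (2 * ln v + y\<^sup>2 / v\<^sup>2) / 2"
      using v by (intro divide_right_mono mult_left_mono) auto
    also have "\<dots> = (v - 1/2) * ln v + (v - 1/2) * (y\<^sup>2 / v\<^sup>2 / 2)"
      by (simp only: distrib_left add_divide_distrib)
    also have "(v - 1/2) * (y\<^sup>2 / v\<^sup>2 / 2) \<le> v * (y\<^sup>2 / v\<^sup>2 / 2)"
      by (intro mult_right_mono) auto
    also have "v * (y\<^sup>2 / v\<^sup>2 / 2) = y\<^sup>2 / (2 * v)"
      using v by (simp add: power2_eq_square)
    finally have "U v \<le> (v - 1/2) * ln v - v - (y * arctan (y / v) + 1 / v - y\<^sup>2 / (2 * v))"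
      unfolding U_def stirling_re_def by simp
    moreover have "a (Suc n) = ln (norm (Gamma w)) - ln (norm (Gamma_series w n)) + ln (fact n)
        + x * ln (real n) - U v"
      unfolding a_def * by (simp add: v_def add_ac)
    moreover have e: "x + real n + 1/2 = v - 1/2" by (simp add: v_def)
    ultimately have "b n \<le> a (Suc n)"
      unfolding b_def v_def[symmetric] e using ln_fact_lower[of n] by simp
    also have "\<dots> \<le> a 0" using \<open>decseq a\<close> by (auto simp: decseq_def)
    finally show ?case .
  qed
  ultimately have "1/2 \<le> a 0"
    by (intro tendsto_upperbound[of b]) auto
  moreover have "1 / x \<le> 1" using x by simp
  ultimately show ?thesis by (simp add: a_def U_def x_def y_def)
qed

subsection \<open>The integrand and its primitive\<close>

text \<open>Jordan's inequality: the concave sine lies above its chord.\<close>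

lemma sin_ge_linear:
  fixes z :: real
  assumes "0 \<le> z" "z \<le> pi / 2"
  shows "2 * z / pi \<le> sin z"
proof -
  have "concave_on {0..pi/2} sin"
  proof (rule f''_le0_imp_concave)
    show "(sin has_real_derivative cos x) (at x)" for x by (auto intro!: derivative_eq_intros)
    show "(cos has_real_derivative - sin x) (at x)" for x by (auto intro!: derivative_eq_intros)
    show "- sin x \<le> 0" if "x \<in> {0..pi/2}" for x using that by (simp add: sin_ge_zero)
  qed auto
  from concave_onD[OF this, of "2 * z / pi" 0 "pi / 2"] assms show ?thesis
    by (simp add: field_simps)
qed

lemma sinh_ge_self:
  fixes z :: real
  assumes "0 \<le> z"
  shows "z \<le> sinh z"
proof -
  have "sinh 0 - 0 \<le> sinh z - z"
    by (rule DERIV_nonneg_imp_nondecreasing[OF assms])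
      (auto intro!: derivative_eq_intros exI cosh_real_ge_1 simp: algebra_simps)
  then show ?thesis by simp
qed

section \<open>Lower bounds for the denominator of the integrand\<close>

definition sin_denom :: "complex \<Rightarrow> complex" where
  "sin_denom u = exp (of_real pi * \<i> * u) - exp (- (of_real pi * \<i> * u))"

lemma sin_denom_eq: "sin_denom u = 2 * \<i> * sin (of_real pi * u)"
  by (simp add: sin_denom_def sin_exp_eq field_simps)

text \<open>The squared norm separates the two coordinates of \<open>u\<close>; the three lower
  bounds that follow keep the sinh term, the sine term, or both.\<close>

lemma norm_sin_denom_sq:
  "(norm (sin_denom u))\<^sup>2 = 4 * ((sin (pi * Re u))\<^sup>2 + (sinh (pi * Im u))\<^sup>2)"
proof -
  have "(norm (sin_denom u))\<^sup>2 = 4 * (norm (sin (of_real pi * u)))\<^sup>2"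
    by (simp add: sin_denom_eq norm_mult power_mult_distrib)
  also have "\<dots> = exp (2 * (pi * Im u)) + inverse (exp (2 * (pi * Im u))) - 2 * cos (2 * (pi * Re u))"
    by (subst norm_sin_squared) simp
  also have "\<dots> = 4 * ((sin (pi * Re u))\<^sup>2 + (sinh (pi * Im u))\<^sup>2)"
  proof -
    have "exp (2 * b) + inverse (exp (2 * b)) - 2 * (1 - 2 * a\<^sup>2) = 4 * (a\<^sup>2 + (sinh b)\<^sup>2)" for a b :: real
    proof -
      have "exp (2 * b) = (exp b)\<^sup>2" by (rule exp_double)
      moreover have "exp b * exp (- b) = 1" by (simp flip: exp_add)
      ultimately show ?thesis
        by (simp add: sinh_def exp_minus power_inverse power2_diff power_divide power2_eq_square algebra_simps)
    qed
    then show ?thesis unfolding cos_double_sin .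
  qed
  finally show ?thesis .
qed

lemma norm_sin_denom_ge_Im: "2 * pi * \<bar>Im u\<bar> \<le> norm (sin_denom u)"
proof -
  have "pi * \<bar>Im u\<bar> \<le> \<bar>sinh (pi * Im u)\<bar>"
    using sinh_ge_self[of "pi * \<bar>Im u\<bar>"] by (simp add: abs_mult flip: sinh_real_abs)
  then have "(pi * \<bar>Im u\<bar>)\<^sup>2 \<le> (sinh (pi * Im u))\<^sup>2"
    by (simp add: abs_mult flip: abs_le_square_iff)
  then have "(2 * pi * \<bar>Im u\<bar>)\<^sup>2 \<le> (norm (sin_denom u))\<^sup>2"
    unfolding norm_sin_denom_sq by (simp add: power_mult_distrib add_increasing)
  then show ?thesis by (rule power2_le_imp_le) simp
qed

text \<open>Translation by an integer multiple of pi changes the sine at most in sign, so Jordan's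
  inequality applies around every zero \<open>n\<close>. This controls a ray where it passes closest
  to a pole.\<close>

lemma norm_sin_denom_ge_Re:
  assumes "\<bar>Re u - of_int n\<bar> \<le> 1/2"
  shows "4 * \<bar>Re u - of_int n\<bar> \<le> norm (sin_denom u)"
proof -
  define z where "z = pi * \<bar>Re u - of_int n\<bar>"
  have "2 * z / pi \<le> sin z"
    using assms by (intro sin_ge_linear) (auto simp: z_def)
  then have "2 * \<bar>Re u - of_int n\<bar> \<le> sin z" by (simp add: z_def)
  then have "(2 * \<bar>Re u - of_int n\<bar>)\<^sup>2 \<le> (sin z)\<^sup>2" by (intro power_mono) auto
  also have "(sin z)\<^sup>2 = (sin (pi * Re u - pi * of_int n))\<^sup>2"
    by (cases "Re u - of_int n \<ge> 0") (auto simp: z_def algebra_simps sin_diff)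
  also have "\<dots> = (sin (pi * Re u))\<^sup>2"
    by (simp add: sin_diff sin_npi_int cos_npi_int power_mult_distrib)
  finally have "(4 * \<bar>Re u - of_int n\<bar>)\<^sup>2 \<le> (norm (sin_denom u))\<^sup>2"
    unfolding norm_sin_denom_sq by (simp add: power_mult_distrib add_increasing2)
  then show ?thesis by (rule power2_le_imp_le) simp
qed

lemma norm_sin_denom_ge_norm:
  assumes "\<bar>Re u\<bar> \<le> 1/2"
  shows "4 * norm u \<le> norm (sin_denom u)"
proof -
  have "(2 * \<bar>Re u\<bar>)\<^sup>2 \<le> (sin (pi * Re u))\<^sup>2"
  proof -
    have "2 * (pi * \<bar>Re u\<bar>) / pi \<le> sin (pi * \<bar>Re u\<bar>)"
      using assms by (intro sin_ge_linear) auto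
    then have "(2 * \<bar>Re u\<bar>)\<^sup>2 \<le> (sin (pi * \<bar>Re u\<bar>))\<^sup>2" by (intro power_mono) auto
    then show ?thesis by (cases "Re u \<ge> 0") auto
  qed
  moreover have "(2 * \<bar>Im u\<bar>)\<^sup>2 \<le> (sinh (pi * Im u))\<^sup>2"
  proof -
    have "2 * \<bar>Im u\<bar> \<le> pi * \<bar>Im u\<bar>" using pi_gt3 by (intro mult_right_mono) auto
    also have "\<dots> \<le> \<bar>sinh (pi * Im u)\<bar>"
      using sinh_ge_self[of "pi * \<bar>Im u\<bar>"] by (simp add: abs_mult flip: sinh_real_abs)
    finally have "(2 * \<bar>Im u\<bar>)\<^sup>2 \<le> \<bar>sinh (pi * Im u)\<bar>\<^sup>2" by (intro power_mono) auto
    then show ?thesis by simp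
  qed
  ultimately have "(4 * norm u)\<^sup>2 \<le> (norm (sin_denom u))\<^sup>2"
    unfolding norm_sin_denom_sq by (simp add: power_mult_distrib cmod_power2)
  then show ?thesis by (rule power2_le_imp_le) simp
qed

lemma norm_integrand:
  assumes "u \<noteq> 0"
  shows "norm (riemann_aux_integrand s u) =
    norm u powr (- Re s) * exp (Im s * Im (Ln u)) * exp (- (2 * pi * Re u * Im u)) / norm (sin_denom u)"
proof -
  have "norm (exp (- s * Ln u)) = norm u powr (- Re s) * exp (Im s * Im (Ln u))"
    using assms by (simp add: powr_def flip: exp_add)
  moreover have "norm (exp (of_real pi * \<i> * u\<^sup>2)) = exp (- (2 * pi * Re u * Im u))"
    by (simp add: power2_eq_square algebra_simps)
  ultimately show ?thesis
    by (simp add: riemann_aux_integrand_def sin_denom_def norm_mult norm_divide)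
qed

text \<open>
  The integrand is holomorphic on this starlike domain, so it has a primitive there, and every
  deformation of contours below is a comparison of values of that primitive.
\<close>

definition slit_strip :: "complex set" where
  "slit_strip = {u. Im u \<noteq> 0 \<or> 0 < Re u \<and> Re u < 1}"

lemma open_slit_strip: "open slit_strip"
proof -
  have "slit_strip = {u. Im u < 0} \<union> {u. Im u > 0} \<union> ({u. Re u > 0} \<inter> {u. Re u < 1})"
    by (auto simp: slit_strip_def)
  then show ?thesis
    using open_Un[OF open_Un[OF open_halfspace_Im_lt[of 0] open_halfspace_Im_gt[of 0]]
      open_Int[OF open_halfspace_Re_gt[of 0] open_halfspace_Re_lt[of 1]]] by simp
qed

lemma starlike_slit_strip: "starlike slit_strip"
  unfolding starlike_def
\<comment> \<open>The star centre 1/2 lies between the branch cut and the pole at 1. A segment from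
  it to a nonreal point meets the real axis only at 1/2 itself.\<close>
proof (intro bexI[of _ "1/2"] ballI subsetI)
  fix u v assume u: "u \<in> slit_strip" and v: "v \<in> closed_segment (1/2) u"
  from v obtain t where t: "0 \<le> t" "t \<le> 1" "v = (1 - t) *\<^sub>R (1/2) + t *\<^sub>R u"
    by (auto simp: in_segment)
  have Re: "Re v = (1 - t) / 2 + t * Re u" and Im: "Im v = t * Im u" using t by auto
  show "v \<in> slit_strip"
  proof (cases "Im u = 0 \<or> t = 0")
    case True
    show ?thesis
    proof (cases "t = 0")
      case False
      with True u have "0 < Re u" "Re u < 1" "Im v = 0" by (auto simp: slit_strip_def Im)
      with False t have "0 < t * Re u" "t * Re u < t * 1"
        by (auto intro!: mult_strict_left_mono)
      then have "0 < (1 - t) / 2 + t * Re u \<and> (1 - t) / 2 + t * Re u < 1" using t(1,2) by argo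
      then have "0 < Re v" "Re v < 1" unfolding Re by auto
      then show ?thesis by (simp add: slit_strip_def)
    qed (simp add: slit_strip_def Re)
  qed (auto simp: slit_strip_def Im)
qed (simp add: slit_strip_def)

lemma slit_strip_nonpos: "u \<in> slit_strip \<Longrightarrow> u \<notin> \<real>\<^sub>\<le>\<^sub>0"
  by (auto simp: slit_strip_def complex_nonpos_Reals_iff)

lemma sin_denom_nonzero:
  assumes "u \<in> slit_strip"
  shows "sin_denom u \<noteq> 0"
proof
  assume "sin_denom u = 0"
  then have "sin (of_real pi * u) = 0" by (simp add: sin_denom_eq)
  then obtain n :: int where "of_real pi * u = of_real (n * pi)" unfolding sin_eq_0 by blast
  then have "u = of_int n" by simp
  with assms show False by (auto simp: slit_strip_def)
qed

lemma integrand_holomorphic: "riemann_aux_integrand s holomorphic_on slit_strip"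
  unfolding riemann_aux_integrand_def[abs_def] using slit_strip_nonpos sin_denom_nonzero
  by (auto intro!: holomorphic_intros simp: sin_denom_def)

lemma integrand_primitive:
  "\<exists>\<Phi>. \<forall>u\<in>slit_strip. (\<Phi> has_field_derivative riemann_aux_integrand s u) (at u)"
  using integrand_holomorphic
  by (intro holomorphic_starlike_primitive[of _ _ "{}"] starlike_slit_strip open_slit_strip)
    (auto intro: holomorphic_on_imp_continuous_on holomorphic_on_imp_differentiable_at[OF _ open_slit_strip])

section \<open>Collapsing the contour onto a line through the origin\<close>

lemma integrand_minus:
  assumes "0 < Im u"
  shows "riemann_aux_integrand s (- u) = - exp (of_real pi * \<i> * s) * riemann_aux_integrand s u"
proof -
  \<comment> \<open>On the upper half plane \<open>- u\<close> has argument smaller by pi. The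
    Gaussian is even and the denominator odd, so only this shift and one sign remain.\<close>
  have "Ln (- u) = Ln u - \<i> * of_real pi"
    using assms by (subst Ln_minus) (auto simp: complex_eq_iff)
  then have "exp (- s * Ln (- u)) = exp (of_real pi * \<i> * s) * exp (- s * Ln u)"
    by (simp only:) (simp add: algebra_simps flip: exp_add)
  moreover have "exp (of_real pi * \<i> * - u) - exp (- (of_real pi * \<i> * - u)) = - sin_denom u"
    by (simp add: sin_denom_def)
  ultimately show ?thesis
    by (simp add: riemann_aux_integrand_def sin_denom_def[symmetric])
qed

lemma exp_Im_Ln_le:
  assumes "u \<noteq> 0"
  shows "exp (t * Im (Ln u)) \<le> exp (\<bar>t\<bar> * pi)"
proof -
  have "\<bar>t * Im (Ln u)\<bar> \<le> \<bar>t\<bar> * pi"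
    using Im_Ln_le_pi[OF assms] mpi_less_Im_Ln[OF assms] unfolding abs_mult
    by (intro mult_left_mono) auto
  then show ?thesis by simp
qed

text \<open>The dominating function is \<open>g\<close> plus the norm of \<open>f\<close> on the
  compact interval where the comparison may fail.\<close>

lemma integrable_if_eventually_le:
  fixes f :: "real \<Rightarrow> complex"
  assumes f: "continuous_on UNIV f"
    and g: "integrable lborel g"
    and top: "eventually (\<lambda>x. norm (f x) \<le> g x) at_top"
    and bot: "eventually (\<lambda>x. norm (f x) \<le> g x) at_bot"
  shows "integrable lborel f"
proof -
  obtain a b where a: "\<And>x. x \<le> a \<Longrightarrow> norm (f x) \<le> g x" and b: "\<And>x. x \<ge> b \<Longrightarrow> norm (f x) \<le> g x"
    using top bot by (auto simp: eventually_at_top_linorder eventually_at_bot_linorder)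
  have "integrable lborel (\<lambda>x. norm (g x) + norm (indicator {a..b} x *\<^sub>R f x))"
    using g borel_integrable_atLeastAtMost'[of a b f] continuous_on_subset[OF f]
    by (intro Bochner_Integration.integrable_add integrable_norm) (auto simp: set_integrable_def)
  then show ?thesis
  proof (rule Bochner_Integration.integrable_bound)
    show "f \<in> borel_measurable lborel"
      using borel_measurable_continuous_onI[OF f] by simp
    have "norm (f x) \<le> norm (norm (g x) + norm (indicator {a..b} x *\<^sub>R f x))" for x
      using a[of x] b[of x] by (cases "x \<in> {a..b}") (auto simp: not_le intro: less_imp_le)
    then show "AE x in lborel. norm (f x) \<le> norm (norm (g x) + norm (indicator {a..b} x *\<^sub>R f x))" by simp
  qed
qed

lemma riemann_path_eq:
  "Re (riemann_path c t) = c - t / sqrt 2" "Im (riemann_path c t) = - t / sqrt 2"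
proof -
  have trig: "cos (3 * pi / 4) = - (1 / sqrt 2)" "sin (3 * pi / 4) = 1 / sqrt 2"
  proof -
    have "3 * pi / 4 = pi - pi / 4" "sqrt 2 / 2 = 1 / sqrt 2"
      by (simp_all add: real_div_sqrt)
    then show "cos (3 * pi / 4) = - (1 / sqrt 2)" "sin (3 * pi / 4) = 1 / sqrt 2"
      by (simp_all only: cos_pi_minus sin_pi_minus cos_45 sin_45)
  qed
  then show "Re (riemann_path c t) = c - t / sqrt 2" "Im (riemann_path c t) = - t / sqrt 2"
    using trig by (simp_all add: riemann_path_def)
qed

lemma riemann_path_in_slit_strip: "0 < c \<Longrightarrow> c < 1 \<Longrightarrow> riemann_path c t \<in> slit_strip"
  by (cases "t = 0") (simp_all add: slit_strip_def riemann_path_eq)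

lemma riemann_path_integrable:
  assumes c: "0 < c" "c < 1" and s: "Re s < 0"
  shows "integrable lborel (\<lambda>t. riemann_aux_integrand s (riemann_path c t) * cis (- (3 * pi / 4)))"
    (is "integrable _ ?f")
proof (rule integrable_if_eventually_le)
  have path: "continuous_on UNIV (riemann_path c)"
    unfolding riemann_path_def[abs_def] by (intro continuous_intros)
  show "continuous_on UNIV ?f"
    using riemann_path_in_slit_strip[OF c]
    by (intro continuous_intros continuous_on_compose2[OF holomorphic_on_imp_continuous_on[OF
        integrand_holomorphic[of s]] path]) auto
  show "integrable lborel (\<lambda>x::real. inverse (1 + x\<^sup>2))"
    using integrable_inverse_1_plus_square by (simp add: set_integrable_def)
  define p where "p = - Re s"
  define K where "K = exp (\<bar>Im s\<bar> * pi)"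
  \<comment> \<open>Only |t| >= 1 is estimated: there the imaginary part of the path is at least 1 /
    sqrt 2 in modulus, which keeps the denominator at least 1. Bounded \<open>t\<close> are covered
    by continuity.\<close>
  have bound: "norm (?f t) \<le> (1 + \<bar>t\<bar>) powr p * K * exp (- (pi * t\<^sup>2) + 2 * pi * \<bar>t\<bar>)"
    if t: "\<bar>t\<bar> \<ge> 1" for t
  proof -
    define u where "u = riemann_path c t"
    have u0: "u \<noteq> 0" using t by (auto simp: u_def complex_eq_iff riemann_path_eq)
    have "norm u \<le> norm (of_real c :: complex) + norm (of_real t * cis (- (3 * pi / 4)))"
      unfolding u_def riemann_path_def by (rule norm_triangle_ineq)
    then have "norm u \<le> 1 + \<bar>t\<bar>" using c by (simp add: norm_mult)
    then have 1: "norm u powr p \<le> (1 + \<bar>t\<bar>) powr p"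
      using s by (intro powr_mono2) (auto simp: p_def)
    have 2: "exp (Im s * Im (Ln u)) \<le> K" unfolding K_def by (rule exp_Im_Ln_le[OF u0])
    have "c * t / sqrt 2 \<le> \<bar>t\<bar>"
    proof -
      have "c * t \<le> c * \<bar>t\<bar>" using c by (intro mult_left_mono) auto
      also have "\<dots> \<le> 1 * \<bar>t\<bar>" using c by (intro mult_right_mono) auto
      finally have "c * t \<le> 1 * \<bar>t\<bar>" .
      moreover have "\<bar>t\<bar> * 1 \<le> \<bar>t\<bar> * sqrt 2" by (intro mult_left_mono) auto
      ultimately show ?thesis by (simp add: divide_le_eq)
    qed
    then have "2 * pi * (c * t / sqrt 2) \<le> 2 * pi * \<bar>t\<bar>" by (intro mult_left_mono) auto
    moreover have "2 * pi * Re u * Im u = pi * t\<^sup>2 - 2 * pi * (c * t / sqrt 2)"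
      by (simp add: u_def riemann_path_eq power2_eq_square field_simps)
    ultimately have 3: "exp (- (2 * pi * Re u * Im u)) \<le> exp (- (pi * t\<^sup>2) + 2 * pi * \<bar>t\<bar>)"
      by simp
    have "1 \<le> 2 * pi * \<bar>Im u\<bar>"
    proof -
      have "1 \<le> 2 * pi * (1 / sqrt 2)"
        using pi_gt3 sqrt2_less_2 by (simp add: field_simps)
      also have "\<dots> \<le> 2 * pi * \<bar>Im u\<bar>"
        using t by (intro mult_left_mono) (auto simp: u_def riemann_path_eq divide_right_mono)
      finally show ?thesis .
    qed
    then have 4: "1 \<le> norm (sin_denom u)" using norm_sin_denom_ge_Im[of u] by linarith
    have "norm (?f t) = norm u powr p * exp (Im s * Im (Ln u)) * exp (- (2 * pi * Re u * Im u)) / norm (sin_denom u)"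
      using u0 by (simp add: norm_mult u_def[symmetric] norm_integrand p_def)
    also have "\<dots> \<le> norm u powr p * exp (Im s * Im (Ln u)) * exp (- (2 * pi * Re u * Im u)) / 1"
      using 4 by (intro divide_left_mono) auto
    also have "\<dots> \<le> (1 + \<bar>t\<bar>) powr p * K * exp (- (pi * t\<^sup>2) + 2 * pi * \<bar>t\<bar>)"
      unfolding div_by_1 using 1 2 3 by (intro mult_mono) (auto simp: K_def)
    finally show ?thesis .
  qed
  have ev: "eventually (\<lambda>t. (1 + t) powr p * K * exp (- (pi * t\<^sup>2) + 2 * pi * t) \<le> inverse (1 + t\<^sup>2)) at_top"
  proof -
    have "((\<lambda>t. (1 + t) powr p * exp (- (pi * t\<^sup>2) + 2 * pi * t) * (1 + t\<^sup>2)) \<longlongrightarrow> 0) at_top"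
      by real_asymp
    then have "eventually (\<lambda>t. (1 + t) powr p * exp (- (pi * t\<^sup>2) + 2 * pi * t) * (1 + t\<^sup>2) < 1 / K) at_top"
      by (rule order_tendstoD) (simp add: K_def)
    then show ?thesis
    proof eventually_elim
      case (elim t)
      have "1 + t\<^sup>2 > 0" by (intro add_pos_nonneg) auto
      with elim show ?case by (simp add: K_def field_simps)
    qed
  qed
  show "eventually (\<lambda>t. norm (?f t) \<le> inverse (1 + t\<^sup>2)) at_top"
    using ev eventually_ge_at_top[of 1]
  proof eventually_elim
    case (elim t)
    with bound[of t] show ?case by simp
  qed
  have "eventually (\<lambda>t. norm (?f (- t)) \<le> inverse (1 + (- t)\<^sup>2)) at_top"
    using ev eventually_ge_at_top[of 1]
  proof eventually_elim
    case (elim t)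
    with bound[of "- t"] show ?case by simp
  qed
  then show "eventually (\<lambda>t. norm (?f t) \<le> inverse (1 + t\<^sup>2)) at_bot"
    by (simp only: at_bot_mirror eventually_filtermap)
qed

text \<open>Dominated convergence replaces the full integral by integrals over [- T, T], which the
  fundamental theorem evaluates through the primitive.\<close>

lemma riemann_aux_tendsto:
  assumes c: "0 < c" "c < 1" and s: "Re s < 0"
    and \<Phi>: "\<And>u. u \<in> slit_strip \<Longrightarrow> (\<Phi> has_field_derivative riemann_aux_integrand s u) (at u)"
  shows "((\<lambda>T. \<Phi> (riemann_path c T) - \<Phi> (riemann_path c (- T))) \<longlongrightarrow> riemann_aux c s) at_top"
proof -
  define f where "f = (\<lambda>t. riemann_aux_integrand s (riemann_path c t) * cis (- (3 * pi / 4)))"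
  have int: "integrable lborel f"
    unfolding f_def by (rule riemann_path_integrable) fact+
  have deriv: "((\<lambda>t. \<Phi> (riemann_path c t)) has_vector_derivative f t) (at t within A)" for t A
  proof -
    have "(riemann_path c has_vector_derivative cis (- (3 * pi / 4))) (at t within A)"
      unfolding riemann_path_def[abs_def]
      by (auto intro!: derivative_eq_intros simp: scaleR_conv_of_real)
    from field_vector_diff_chain_within[OF this
        has_field_derivative_at_within[OF \<Phi>[OF riemann_path_in_slit_strip[OF c]]]]
    show ?thesis by (simp add: f_def o_def mult.commute)
  qed
  have cont: "continuous_on A f" for A
    unfolding f_def riemann_path_def[abs_def]
    using riemann_path_in_slit_strip[OF c, unfolded riemann_path_def]
    by (intro continuous_intros continuous_on_compose2[OF holomorphic_on_imp_continuous_on[OF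
        integrand_holomorphic[of s]]]) auto
  have "((\<lambda>T. LINT t|lborel. indicator {- T..T} t *\<^sub>R f t) \<longlongrightarrow> integral\<^sup>L lborel f) at_top"
  proof (rule integral_dominated_convergence_at_top)
    show "integrable lborel (\<lambda>t. norm (f t))" using int by (rule integrable_norm)
    show "AE x in lborel. ((\<lambda>T. indicator {- T..T} x *\<^sub>R f x) \<longlongrightarrow> f x) at_top"
    proof (rule AE_I2)
      fix x
      have "eventually (\<lambda>T. indicator {- T..T} x *\<^sub>R f x = f x) at_top"
        using eventually_ge_at_top[of "\<bar>x\<bar>"] by eventually_elim (auto simp: indicator_def)
      then show "((\<lambda>T. indicator {- T..T} x *\<^sub>R f x) \<longlongrightarrow> f x) at_top"
        by (rule tendsto_eventually)
    qed
  qed (use int in \<open>auto intro!: always_eventually simp: indicator_def\<close>)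
  moreover have "eventually (\<lambda>T. (LINT t|lborel. indicator {- T..T} t *\<^sub>R f t) =
      \<Phi> (riemann_path c T) - \<Phi> (riemann_path c (- T))) at_top"
    using eventually_ge_at_top[of 0]
    by eventually_elim (rule integral_FTC_atLeastAtMost[OF _ deriv cont], simp)
  ultimately show ?thesis
    by (simp add: riemann_aux_def f_def tendsto_cong)
qed

lemma norm_primitive_diff_le:
  assumes \<Phi>: "\<And>u. u \<in> slit_strip \<Longrightarrow> (\<Phi> has_field_derivative riemann_aux_integrand s u) (at u)"
    and S: "convex S" "S \<subseteq> slit_strip"
    and B: "\<And>u. u \<in> S \<Longrightarrow> norm (riemann_aux_integrand s u) \<le> B"
    and uv: "u \<in> S" "v \<in> S"
  shows "norm (\<Phi> u - \<Phi> v) \<le> B * norm (u - v)"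
  by (rule field_differentiable_bound[OF S(1) _ B uv])
    (use S \<Phi> in \<open>auto intro: has_field_derivative_at_within\<close>)

text \<open>For \<open>e = 1\<close> and \<open>e = - 1\<close> and positive \<open>a\<close> these
  are truncated first and third quadrants, where Re u Im u > 0 and the Gaussian factor
  decays.\<close>

lemma convex_quadrant_ball:
  "convex {u. a \<le> e * Re u \<and> a \<le> e * Im u \<and> norm u \<le> R}"
proof -
  have "{u. a \<le> e * Re u \<and> a \<le> e * Im u \<and> norm u \<le> R} =
      {u. inner (of_real e) u \<ge> a} \<inter> {u. inner (e *\<^sub>R \<i>) u \<ge> a} \<inter> cball 0 R"
    by (auto simp: inner_complex_def)
  then show ?thesis
    by (simp only: convex_Int convex_halfspace_ge convex_cball)
qed

text \<open>Both points lie in one convex truncated quadrant on which Re u Im u >= \<kappa>^2 T^2.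
  The mean value inequality gives a Gaussian in T against a power of T, so the ends of contours may
  be moved freely within a quadrant.\<close>

lemma primitive_far:
  assumes s: "Re s < 0"
    and \<Phi>: "\<And>u. u \<in> slit_strip \<Longrightarrow> (\<Phi> has_field_derivative riemann_aux_integrand s u) (at u)"
    and \<kappa>: "\<kappa> > 0" "K > 0" and e: "e = 1 \<or> e = - 1"
    and p: "eventually (\<lambda>T. p T \<in> {u. \<kappa> * T \<le> e * Re u \<and> \<kappa> * T \<le> e * Im u \<and> norm u \<le> K * T}) at_top"
    and q: "eventually (\<lambda>T. q T \<in> {u. \<kappa> * T \<le> e * Re u \<and> \<kappa> * T \<le> e * Im u \<and> norm u \<le> K * T}) at_top"
  shows "((\<lambda>T. \<Phi> (p T) - \<Phi> (q T)) \<longlongrightarrow> 0) at_top"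
proof -
  define k where "k = 2 * pi * \<kappa>\<^sup>2"
  have k: "k > 0" using \<kappa> by (simp add: k_def)
  define r where "r = - Re s"
  define E where "E = exp (\<bar>Im s\<bar> * pi)"
  have "((\<lambda>T. (K * T) powr r * E * exp (- (k * T\<^sup>2)) * (2 * K * T)) \<longlongrightarrow> 0) at_top"
    using k \<kappa> by real_asymp
  moreover have "eventually (\<lambda>T. norm (\<Phi> (p T) - \<Phi> (q T)) \<le>
      (K * T) powr r * E * exp (- (k * T\<^sup>2)) * (2 * K * T)) at_top"
    using p q eventually_ge_at_top[of "1 / \<kappa>"]
  proof eventually_elim
    case (elim T)
    define S where "S = {u. \<kappa> * T \<le> e * Re u \<and> \<kappa> * T \<le> e * Im u \<and> norm u \<le> K * T}"
    have kT: "\<kappa> * T \<ge> 1" using elim(3) \<kappa> by (simp add: field_simps)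
    have T: "T > 0" using elim(3) \<kappa> by (meson divide_pos_pos less_le_trans zero_less_one)
    have "norm (\<Phi> (p T) - \<Phi> (q T)) \<le> ((K * T) powr r * E * exp (- (k * T\<^sup>2))) * norm (p T - q T)"
    proof (rule norm_primitive_diff_le[OF \<Phi>, where S = S])
      show "convex S" unfolding S_def by (rule convex_quadrant_ball)
      show "S \<subseteq> slit_strip" using kT by (auto simp: S_def slit_strip_def)
      fix u assume u: "u \<in> S"
      have u0: "u \<noteq> 0" using u kT by (auto simp: S_def)
      have 1: "norm u powr r \<le> (K * T) powr r"
        using u s by (intro powr_mono2) (auto simp: r_def S_def)
      have "(\<kappa> * T) * (\<kappa> * T) \<le> (e * Re u) * (e * Im u)"
        by (rule mult_mono) (use u kT in \<open>auto simp: S_def\<close>)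
      also have "\<dots> = Re u * Im u" using e by auto
      finally have "2 * pi * ((\<kappa> * T) * (\<kappa> * T)) \<le> 2 * pi * (Re u * Im u)"
        by (intro mult_left_mono) auto
      then have 3: "exp (- (2 * pi * Re u * Im u)) \<le> exp (- (k * T\<^sup>2))"
        by (simp add: k_def power2_eq_square mult_ac)
      have "1 * 1 \<le> 2 * pi * \<bar>Im u\<bar>"
        using u kT e pi_gt3 by (intro mult_mono) (auto simp: S_def)
      then have 4: "1 \<le> norm (sin_denom u)" using norm_sin_denom_ge_Im[of u] by linarith
      have "norm (riemann_aux_integrand s u) \<le>
          norm u powr r * exp (Im s * Im (Ln u)) * exp (- (2 * pi * Re u * Im u)) / 1"
        unfolding norm_integrand[OF u0] r_def using 4 by (intro divide_left_mono) auto
      also have "\<dots> \<le> (K * T) powr r * E * exp (- (k * T\<^sup>2))"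
        unfolding div_by_1 E_def using 1 3 exp_Im_Ln_le[OF u0] by (intro mult_mono) auto
      finally show "norm (riemann_aux_integrand s u) \<le> (K * T) powr r * E * exp (- (k * T\<^sup>2))" .
    qed (use elim in \<open>auto simp: S_def\<close>)
    also have "\<dots> \<le> ((K * T) powr r * E * exp (- (k * T\<^sup>2))) * (2 * K * T)"
      using elim norm_triangle_ineq4[of "p T" "q T"]
      by (intro mult_left_mono) (auto simp: E_def)
    finally show ?case .
  qed
  ultimately show ?thesis
    by (rule Lim_null_comparison[rotated])
qed

text \<open>A detour around 0 of length O(\<epsilon>) stays at distance at least a multiple of
  \<epsilon> from 0, where the integrand is O(\<epsilon>^(r - 1)) with r = - Re s. The product
  O(\<epsilon>^r) vanishes because r > 0.\<close>

lemma primitive_near_0: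
  assumes s: "Re s < 0" and d: "Re d > 0" "Im d > 0"
    and \<Phi>: "\<And>u. u \<in> slit_strip \<Longrightarrow> (\<Phi> has_field_derivative riemann_aux_integrand s u) (at u)"
  shows "((\<lambda>\<epsilon>. \<Phi> (- (of_real \<epsilon> * d)) - \<Phi> (of_real \<epsilon> * d)) \<longlongrightarrow> 0) (at_right 0)"
proof -
  define r where "r = - Re s"
  have r: "r > 0" using s by (simp add: r_def)
  define E where "E = exp (\<bar>Im s\<bar> * pi)"
  define \<mu> where "\<mu> = min (Re d) (Im d)"
  have \<mu>: "\<mu> > 0" "\<mu> \<le> Re d" "\<mu> \<le> Im d" using d by (auto simp: \<mu>_def)
  define N where "N = norm d"
  have N: "N > 0" using d by (auto simp: N_def)
  define M where "M = E * exp (2 * pi) / \<mu> * (4 * N)"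
  have bound: "norm (riemann_aux_integrand s u) \<le> (\<epsilon> * N) powr r * E * exp (2 * pi) / (\<epsilon> * \<mu>)"
    if u: "\<epsilon> * \<mu> \<le> norm u" "norm u \<le> \<epsilon> * N" and \<epsilon>: "0 < \<epsilon>" "\<epsilon> * N \<le> 1/2" for u \<epsilon>
  proof -
    have "\<epsilon> * \<mu> > 0" using \<epsilon> \<mu> by simp
    then have u0: "u \<noteq> 0" using u by auto
    have 1: "norm u powr r \<le> (\<epsilon> * N) powr r"
      using u r by (intro powr_mono2) auto
    have ab: "\<bar>Re u\<bar> \<le> 1/2" "\<bar>Im u\<bar> \<le> 1/2"
      using u \<epsilon> abs_Re_le_cmod[of u] abs_Im_le_cmod[of u] by linarith+
    have "\<bar>Re u * Im u\<bar> \<le> 1 * 1" unfolding abs_mult using ab by (intro mult_mono) auto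
    then have "2 * pi * - (Re u * Im u) \<le> 2 * pi * 1" by (intro mult_left_mono) auto
    then have 3: "exp (- (2 * pi * Re u * Im u)) \<le> exp (2 * pi)" by (simp add: mult_ac)
    have "\<epsilon> * \<mu> \<le> 4 * norm u" using u \<open>\<epsilon> * \<mu> > 0\<close> by linarith
    then have 4: "\<epsilon> * \<mu> \<le> norm (sin_denom u)"
      using norm_sin_denom_ge_norm[OF ab(1)] by linarith
    have "norm (riemann_aux_integrand s u) \<le>
        norm u powr r * exp (Im s * Im (Ln u)) * exp (- (2 * pi * Re u * Im u)) / (\<epsilon> * \<mu>)"
      unfolding norm_integrand[OF u0] r_def using 4 \<epsilon> \<mu> less_le_trans[OF \<open>\<epsilon> * \<mu> > 0\<close> 4]
      by (intro divide_left_mono mult_pos_pos) auto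
    also have "\<dots> \<le> (\<epsilon> * N) powr r * E * exp (2 * pi) / (\<epsilon> * \<mu>)"
      unfolding E_def using 1 3 exp_Im_Ln_le[OF u0] \<open>\<epsilon> * \<mu> > 0\<close>
      by (intro divide_right_mono mult_mono) auto
    finally show ?thesis .
  qed
  have "((\<lambda>\<epsilon>. (\<epsilon> * N) powr r * M) \<longlongrightarrow> 0) (at_right 0)"
    using r N by real_asymp
  moreover have "eventually (\<lambda>\<epsilon>. norm (\<Phi> (- (of_real \<epsilon> * d)) - \<Phi> (of_real \<epsilon> * d)) \<le>
      (\<epsilon> * N) powr r * M) (at_right 0)"
  proof -
    have "eventually (\<lambda>\<epsilon>. \<epsilon> \<in> {0<..<1 / (2 * N)}) (at_right 0)"
      using N by (intro eventually_at_right_real) simp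
    then show ?thesis
    proof eventually_elim
      case (elim \<epsilon>)
      have \<epsilon>: "0 < \<epsilon>" "\<epsilon> * N \<le> 1/2" using elim N by (auto simp: field_simps)
      define B where "B = (\<epsilon> * N) powr r * E * exp (2 * pi) / (\<epsilon> * \<mu>)"
      have B: "B \<ge> 0" using \<epsilon> \<mu> by (auto simp: B_def E_def)
      \<comment> \<open>The detour must avoid the branch cut, so it runs through the fourth
        quadrant: vertically from \<epsilon> d to its conjugate \<open>m\<close>, then horizontally
        below the real axis to - \<epsilon> d.\<close>
      define m where "m = of_real \<epsilon> * cnj d"
      have Re1: "\<epsilon> * Re d < 1" 
      proof -
        have "\<epsilon> * Re d \<le> \<epsilon> * N" using \<epsilon> complex_Re_le_cmod[of d] by (intro mult_left_mono) (auto simp: N_def)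
        then show ?thesis using \<epsilon> by linarith
      qed
      have cv: "convex {u. Re u = x}" "convex {u. Im u = y}" for x y
        by (auto simp: convex_def algebra_simps simp flip: distrib_right)
      have nm: "norm (of_real \<epsilon> * d) = \<epsilon> * N" "norm m = \<epsilon> * N"
        using \<epsilon> by (simp_all add: m_def N_def norm_mult)
      have 1: "norm (\<Phi> m - \<Phi> (of_real \<epsilon> * d)) \<le> B * norm (m - of_real \<epsilon> * d)"
      proof (rule norm_primitive_diff_le[OF \<Phi>, where S = "{u. Re u = \<epsilon> * Re d} \<inter> cball 0 (\<epsilon> * N)"])
        show "convex ({u. Re u = \<epsilon> * Re d} \<inter> cball 0 (\<epsilon> * N))" by (intro convex_Int cv convex_cball)
        show "{u. Re u = \<epsilon> * Re d} \<inter> cball 0 (\<epsilon> * N) \<subseteq> slit_strip"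
          using \<epsilon> d Re1 by (auto simp: slit_strip_def)
        fix u assume u: "u \<in> {u. Re u = \<epsilon> * Re d} \<inter> cball 0 (\<epsilon> * N)"
        have "\<epsilon> * \<mu> \<le> \<epsilon> * Re d" using \<epsilon> \<mu> by (intro mult_left_mono) auto
        also have "\<dots> \<le> norm u" using u complex_Re_le_cmod[of u] by simp
        finally show "norm (riemann_aux_integrand s u) \<le> B"
          unfolding B_def using u \<epsilon> by (intro bound) auto
      qed (use nm in \<open>auto simp: m_def\<close>)
      have 2: "norm (\<Phi> (- (of_real \<epsilon> * d)) - \<Phi> m) \<le> B * norm (- (of_real \<epsilon> * d) - m)"
      proof (rule norm_primitive_diff_le[OF \<Phi>, where S = "{u. Im u = - \<epsilon> * Im d} \<inter> cball 0 (\<epsilon> * N)"])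
        show "convex ({u. Im u = - \<epsilon> * Im d} \<inter> cball 0 (\<epsilon> * N))" by (intro convex_Int cv convex_cball)
        show "{u. Im u = - \<epsilon> * Im d} \<inter> cball 0 (\<epsilon> * N) \<subseteq> slit_strip"
          using \<epsilon> d by (auto simp: slit_strip_def)
        fix u assume u: "u \<in> {u. Im u = - \<epsilon> * Im d} \<inter> cball 0 (\<epsilon> * N)"
        have "\<epsilon> * \<mu> \<le> \<epsilon> * Im d" using \<epsilon> \<mu> by (intro mult_left_mono) auto
        also have "\<dots> \<le> norm u" using u abs_Im_le_cmod[of u] by simp
        finally show "norm (riemann_aux_integrand s u) \<le> B"
          unfolding B_def using u \<epsilon> by (intro bound) auto
      qed (use nm in \<open>auto simp: m_def\<close>)
      have "norm (m - of_real \<epsilon> * d) \<le> 2 * (\<epsilon> * N)" "norm (- (of_real \<epsilon> * d) - m) \<le> 2 * (\<epsilon> * N)"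
        using norm_triangle_ineq4[of m "of_real \<epsilon> * d"] norm_triangle_ineq4[of "- (of_real \<epsilon> * d)" m] nm
        unfolding norm_minus_cancel by linarith+
      then have "B * norm (m - of_real \<epsilon> * d) + B * norm (- (of_real \<epsilon> * d) - m) \<le>
          B * (2 * (\<epsilon> * N)) + B * (2 * (\<epsilon> * N))"
        using B by (intro add_mono mult_left_mono) auto
      also have "\<dots> = (\<epsilon> * N) powr r * M"
        using \<epsilon> \<mu> by (simp add: B_def M_def field_simps)
      finally show ?case
        using 1 2 norm_triangle_ineq[of "\<Phi> (- (of_real \<epsilon> * d)) - \<Phi> m" "\<Phi> m - \<Phi> (of_real \<epsilon> * d)"]
        by simp
    qed
 qed
  ultimately show ?thesis
    by (rule Lim_null_comparison[rotated])
qed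

text \<open>This is \<open>integrand_minus\<close> integrated over the upper half plane. The
  constant \<open>k\<close> cancels in the differences taken later.\<close>

lemma primitive_minus:
  assumes \<Phi>: "\<And>u. u \<in> slit_strip \<Longrightarrow> (\<Phi> has_field_derivative riemann_aux_integrand s u) (at u)"
  obtains k where "\<And>u. Im u > 0 \<Longrightarrow> \<Phi> (- u) = exp (of_real pi * \<i> * s) * \<Phi> u + k"
proof -
  define h where "h = (\<lambda>u. \<Phi> (- u) - exp (of_real pi * \<i> * s) * \<Phi> u)"
  have "(h has_field_derivative 0) (at u within {u. Im u > 0})" if "u \<in> {u. Im u > 0}" for u
  proof -
    have "u \<in> slit_strip" "- u \<in> slit_strip" using that by (auto simp: slit_strip_def)
    note D = DERIV_chain2[OF \<Phi>[OF this(2)] DERIV_minus[OF DERIV_ident]] \<Phi>[OF this(1)]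
    have "(h has_field_derivative riemann_aux_integrand s (- u) * - 1
        - exp (of_real pi * \<i> * s) * riemann_aux_integrand s u) (at u)"
      unfolding h_def by (intro DERIV_diff D DERIV_cmult)
    then show ?thesis
      using that by (auto simp: integrand_minus intro: has_field_derivative_at_within)
  qed
  then obtain k where "\<And>u. Im u > 0 \<Longrightarrow> h u = k"
    using has_field_derivative_zero_constant[OF convex_halfspace_Im_gt[of 0], of h] by blast
  then show ?thesis by (intro that[of k]) (auto simp: h_def algebra_simps)
qed

text \<open>The ends of the path are moved to T d and - T d, and the difference across 0, which
  tends to 0, is subtracted. By \<open>primitive_minus\<close> what remains is (e - 1) times the
  difference of the primitive along the ray of direction \<open>d\<close>. The ends n + 1/2 suit a
  ray that is cut midway between the poles.\<close>

lemma riemann_aux_le: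
  assumes c: "0 < c" "c < 1" and s: "Re s < 0" and d: "Re d > 0" "Im d > 0"
    and \<Phi>: "\<And>u. u \<in> slit_strip \<Longrightarrow> (\<Phi> has_field_derivative riemann_aux_integrand s u) (at u)"
    and B: "\<And>\<epsilon> n. 0 < \<epsilon> \<Longrightarrow> \<epsilon> < 1/2 \<Longrightarrow>
      norm (\<Phi> (of_real (real n + 1/2) * d) - \<Phi> (of_real \<epsilon> * d)) \<le> B"
  shows "norm (riemann_aux c s) \<le> norm (exp (of_real pi * \<i> * s) - 1) * B"
proof -
  define e where "e = exp (of_real pi * \<i> * s)"
  obtain k where k: "\<And>u. Im u > 0 \<Longrightarrow> \<Phi> (- u) = e * \<Phi> u + k"
    using primitive_minus[OF \<Phi>] unfolding e_def by blast
  \<comment> \<open>The bounds 1/4 and 2 put the ends of the original path into the truncated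
    quadrants once T >= 4; the terms in \<open>d\<close> do the same for T d and - T d.\<close>
  define \<kappa> where "\<kappa> = min (1/4) (min (Re d) (Im d))"
  define K where "K = max 2 (norm d)"
  have \<kappa>: "\<kappa> > 0" "\<kappa> \<le> 1/4" "\<kappa> \<le> Re d" "\<kappa> \<le> Im d" using d by (auto simp: \<kappa>_def)
  have K: "K > 0" "K \<ge> 2" "norm d \<le> K" by (auto simp: K_def)
  have path: "T / 4 \<le> T / sqrt 2 - c" "T / 4 \<le> T / sqrt 2" "norm (riemann_path c T) \<le> 2 * T"
    "norm (riemann_path c (- T)) \<le> 2 * T" if T: "T \<ge> 4" for T
  proof -
    have "T / 2 \<le> T / sqrt 2" using T sqrt2_less_2 by (intro divide_left_mono) auto
    then show "T / 4 \<le> T / sqrt 2 - c" "T / 4 \<le> T / sqrt 2" using T c by linarith+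
    have "norm (riemann_path c t) \<le> 1 + \<bar>t\<bar>" for t
      using norm_triangle_ineq[of "of_real c :: complex" "of_real t * cis (- (3 * pi / 4))"] c
      by (simp add: riemann_path_def norm_mult)
    from this[of T] this[of "- T"]
    show "norm (riemann_path c T) \<le> 2 * T" "norm (riemann_path c (- T)) \<le> 2 * T" using T by auto
  qed
  have kT: "\<kappa> * T \<le> T / 4" "\<kappa> * T \<le> T * Re d" "\<kappa> * T \<le> T * Im d" "2 * T \<le> K * T" "T * norm d \<le> K * T"
    if "T \<ge> 4" for T
    using mult_right_mono[OF \<kappa>(2), of T] mult_right_mono[OF \<kappa>(3), of T] mult_right_mono[OF \<kappa>(4), of T]
      mult_right_mono[OF K(2), of T] mult_right_mono[OF K(3), of T] that by (auto simp: mult_ac)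
  have far1: "((\<lambda>T. \<Phi> (of_real T * d) - \<Phi> (riemann_path c (- T))) \<longlongrightarrow> 0) at_top"
  proof (rule primitive_far[OF s \<Phi> \<kappa>(1) K(1), where e = 1])
    show "eventually (\<lambda>T. of_real T * d \<in> {u. \<kappa> * T \<le> 1 * Re u \<and> \<kappa> * T \<le> 1 * Im u \<and> norm u \<le> K * T}) at_top"
      using eventually_ge_at_top[of 4] by eventually_elim (use kT in \<open>auto simp: norm_mult\<close>)
    show "eventually (\<lambda>T. riemann_path c (- T) \<in> {u. \<kappa> * T \<le> 1 * Re u \<and> \<kappa> * T \<le> 1 * Im u \<and> norm u \<le> K * T}) at_top"
      using eventually_ge_at_top[of 4]
    proof eventually_elim
      case (elim T)
      have "\<kappa> * T \<le> c + T / sqrt 2" "\<kappa> * T \<le> T / sqrt 2" "norm (riemann_path c (- T)) \<le> K * T"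
        using path[OF elim] kT[OF elim] c by linarith+
      then show ?case by (simp add: riemann_path_eq)
    qed
  qed auto
  have far2: "((\<lambda>T. \<Phi> (- (of_real T * d)) - \<Phi> (riemann_path c T)) \<longlongrightarrow> 0) at_top"
  proof (rule primitive_far[OF s \<Phi> \<kappa>(1) K(1), where e = "- 1"])
    show "eventually (\<lambda>T. - (of_real T * d) \<in> {u. \<kappa> * T \<le> - 1 * Re u \<and> \<kappa> * T \<le> - 1 * Im u \<and> norm u \<le> K * T}) at_top"
      using eventually_ge_at_top[of 4] by eventually_elim (use kT in \<open>auto simp: norm_mult\<close>)
    show "eventually (\<lambda>T. riemann_path c T \<in> {u. \<kappa> * T \<le> - 1 * Re u \<and> \<kappa> * T \<le> - 1 * Im u \<and> norm u \<le> K * T}) at_top"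
      using eventually_ge_at_top[of 4]
    proof eventually_elim
      case (elim T)
      have "\<kappa> * T \<le> T / sqrt 2 - c" "\<kappa> * T \<le> T / sqrt 2" "norm (riemann_path c T) \<le> K * T"
        using path[OF elim] kT[OF elim] c by linarith+
      then show ?case by (simp add: riemann_path_eq)
    qed
  qed auto
  have "((\<lambda>T. (\<Phi> (riemann_path c T) - \<Phi> (riemann_path c (- T))) + (\<Phi> (- (of_real T * d)) - \<Phi> (riemann_path c T))
      - (\<Phi> (of_real T * d) - \<Phi> (riemann_path c (- T)))) \<longlongrightarrow> riemann_aux c s + 0 - 0) at_top"
    by (intro tendsto_diff tendsto_add far1 far2 riemann_aux_tendsto[OF c s \<Phi>])
  then have "((\<lambda>T. \<Phi> (- (of_real T * d)) - \<Phi> (of_real T * d)) \<longlongrightarrow> riemann_aux c s) at_top"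
    by simp
  moreover have "filterlim (\<lambda>n. real n + 1/2) at_top sequentially" by real_asymp
  ultimately have lim: "(\<lambda>n. \<Phi> (- (of_real (real n + 1/2) * d)) - \<Phi> (of_real (real n + 1/2) * d)) \<longlonglongrightarrow> riemann_aux c s"
    by (rule filterlim_compose)
  \<comment> \<open>This zero limit is what permits inserting the difference at \<epsilon> into the
    bound for fixed \<open>n\<close>: at each positive \<epsilon> the constant \<open>k\<close>
    cancels, and \<epsilon> then tends to 0.\<close>
  have near: "((\<lambda>\<epsilon>. \<Phi> (- (of_real \<epsilon> * d)) - \<Phi> (of_real \<epsilon> * d)) \<longlongrightarrow> 0) (at_right 0)"
    by (rule primitive_near_0[OF s d \<Phi>])
  have "norm ((\<Phi> (- (of_real (real n + 1/2) * d)) - \<Phi> (of_real (real n + 1/2) * d)) - 0) \<le> norm (e - 1) * B" for n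
  proof (rule tendsto_upperbound)
    show "((\<lambda>\<epsilon>. norm ((\<Phi> (- (of_real (real n + 1/2) * d)) - \<Phi> (of_real (real n + 1/2) * d)) -
        (\<Phi> (- (of_real \<epsilon> * d)) - \<Phi> (of_real \<epsilon> * d)))) \<longlongrightarrow>
        norm ((\<Phi> (- (of_real (real n + 1/2) * d)) - \<Phi> (of_real (real n + 1/2) * d)) - 0)) (at_right 0)"
      by (intro tendsto_norm tendsto_diff tendsto_const near)
    show "eventually (\<lambda>\<epsilon>. norm ((\<Phi> (- (of_real (real n + 1/2) * d)) - \<Phi> (of_real (real n + 1/2) * d)) -
        (\<Phi> (- (of_real \<epsilon> * d)) - \<Phi> (of_real \<epsilon> * d))) \<le> norm (e - 1) * B) (at_right 0)"
      using eventually_at_right_real[of 0 "1/2", simplified]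
    proof eventually_elim
      case (elim \<epsilon>)
      have I: "Im (of_real \<epsilon> * d) > 0" "Im (of_real (real n + 1/2) * d) > 0"
        using d elim by (auto intro!: mult_pos_pos)
      have "(\<Phi> (- (of_real (real n + 1/2) * d)) - \<Phi> (of_real (real n + 1/2) * d)) -
          (\<Phi> (- (of_real \<epsilon> * d)) - \<Phi> (of_real \<epsilon> * d)) =
          (e - 1) * (\<Phi> (of_real (real n + 1/2) * d) - \<Phi> (of_real \<epsilon> * d))"
        unfolding k[OF I(1)] k[OF I(2)] by (simp add: algebra_simps)
      then show ?case
        using B[of \<epsilon> n] elim by (simp add: norm_mult mult_left_mono)
    qed
  qed simp
  then show ?thesis
    using tendsto_upperbound[OF tendsto_norm[OF lim], of "norm (e - 1) * B"] by (simp add: e_def)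
qed

subsection \<open>The factor \<open>\<chi>\<close>\<close>

text \<open>Duplication at (1 - s) / 2 introduces Gamma (1 - s / 2), and reflection at s / 2 removes
  it again in favour of the sine. Working with \<open>rGamma\<close> keeps the identity valid at the
  poles of Gamma (s / 2).\<close>

lemma zeta_chi_eq:
  assumes "Re s < 0"
  shows "zeta_chi s = of_real (2 * pi) powr s / of_real pi * sin (of_real pi * s / 2) * Gamma (1 - s)"
proof -
  have nz: "z \<notin> \<int>\<^sub>\<le>\<^sub>0" if "Re z > 0" for z
    using that by (auto elim!: nonpos_Ints_cases)
  have eqs: "(1 - s) / 2 + 1 / 2 = 1 - s / 2" "2 * ((1 - s) / 2) = 1 - s" "1 - (1 - s) = s"
    by (simp_all add: field_simps)
  have dup: "Gamma ((1 - s) / 2) * Gamma (1 - s / 2) =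
      exp (s * of_real (ln 2)) * of_real (sqrt pi) * Gamma (1 - s)"
    using assms by (intro Gamma_legendre_duplication[of "(1 - s) / 2", unfolded eqs] nz) auto
  have refl: "rGamma (s / 2) * rGamma (1 - s / 2) = sin (of_real pi * s / 2) / of_real pi"
    using rGamma_reflection_complex[of "s / 2"] by simp
  have one: "Gamma (1 - s / 2) * rGamma (1 - s / 2) = 1"
    using nz[of "1 - s / 2"] assms by (simp add: Gamma_def rGamma_eq_zero_iff)
  have "Gamma ((1 - s) / 2) * rGamma (s / 2) * (Gamma (1 - s / 2) * rGamma (1 - s / 2)) =
      (Gamma ((1 - s) / 2) * Gamma (1 - s / 2)) * (rGamma (s / 2) * rGamma (1 - s / 2))"
    by (simp only: mult_ac)
  then have G: "Gamma ((1 - s) / 2) * rGamma (s / 2) =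
      exp (s * of_real (ln 2)) * of_real (sqrt pi) * Gamma (1 - s) * (sin (of_real pi * s / 2) / of_real pi)"
    unfolding dup refl one by (simp only: mult_1_right)
  have "of_real (sqrt pi) = (of_real pi powr (1/2) :: complex)"
    using powr_of_real[of pi "1/2"] by (simp add: powr_half_sqrt)
  then have pi: "of_real pi powr (s - 1/2) * of_real (sqrt pi) = (of_real pi powr s :: complex)"
    by (simp flip: powr_add)
  have "Ln (of_real (2 * pi)) = of_real (ln 2) + of_real (ln pi)"
    by (subst Ln_of_real) (simp_all add: ln_mult)
  then have 2: "exp (s * of_real (ln 2)) * of_real pi powr s = (of_real (2 * pi) powr s :: complex)"
    by (simp add: powr_def Ln_of_real distrib_left exp_add)
  have "zeta_chi s = of_real pi powr (s - 1/2) * (Gamma ((1 - s) / 2) * rGamma (s / 2))"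
    unfolding zeta_chi_def rGamma_inverse_Gamma by (simp only: divide_inverse mult.assoc)
  also have "\<dots> = (exp (s * of_real (ln 2)) * (of_real pi powr (s - 1/2) * of_real (sqrt pi))) /
      of_real pi * sin (of_real pi * s / 2) * Gamma (1 - s)"
    unfolding G by (simp only: times_divide_eq_right times_divide_eq_left mult_ac)
  finally show ?thesis unfolding pi 2 .
qed

text \<open>The sine is rewritten so that exactly the factor of \<open>riemann_aux_le\<close>
  appears, vanishing at the zeros of \<open>zeta_chi\<close>.\<close>

lemma norm_zeta_chi:
  assumes "Re s < 0"
  shows "norm (zeta_chi s) = norm (exp (of_real pi * \<i> * s) - 1) *
    (norm (Gamma (1 - s)) * (2 * pi) powr (Re s - 1) * exp (pi * Im s / 2))"
proof -
  define z where "z = of_real pi * s / 2"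
  have "exp (of_real pi * \<i> * s) - 1 = exp (\<i> * z) * (exp (\<i> * z) - exp (- (\<i> * z)))"
    by (simp add: z_def algebra_simps flip: exp_add)
  also have "exp (\<i> * z) - exp (- (\<i> * z)) = 2 * \<i> * sin z"
    by (simp add: sin_exp_eq)
  finally have "norm (exp (of_real pi * \<i> * s) - 1) = exp (- (pi * Im s / 2)) * (2 * norm (sin z))"
    by (simp add: norm_mult z_def)
  then have "norm (sin z) = norm (exp (of_real pi * \<i> * s) - 1) * exp (pi * Im s / 2) / 2"
    by (simp add: exp_minus field_simps)
  moreover have "norm (of_real (2 * pi) powr s :: complex) = (2 * pi) powr Re s"
    by (subst norm_powr_real_powr) auto
  moreover have "(2 * pi) powr Re s = 2 * pi * (2 * pi) powr (Re s - 1)"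
    by (simp add: powr_diff)
  ultimately show ?thesis
    unfolding zeta_chi_eq[OF assms] z_def[symmetric] by (simp add: norm_mult norm_divide)
qed

text \<open>The Stirling bound in saddle variables: the power of 2 pi turns ln |w| into
  \<open>L\<close>, the factor exp (- pi Im w / 2) completes the argument of w to 2 \<alpha>, and
  the - 1/2 in Stirling's formula leaves the square root.\<close>

lemma Gamma_factor_ge:
  fixes w :: complex
  assumes w: "1 \<le> Re w"
  defines "L \<equiv> ln (norm w / (2 * pi))" and "\<alpha> \<equiv> pi / 4 + arctan (Im w / Re w) / 2"
  shows "exp (Re w * (L - 1) - 2 * Im w * \<alpha> - 1) / sqrt (norm w) \<le>
    norm (Gamma w) * (2 * pi) powr (- Re w) * exp (- (pi * Im w / 2))"
proof -
  have nw: "norm w > 0" using w by auto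
  have nz: "norm (Gamma w) > 0"
    using w by (auto simp: Gamma_eq_zero_iff elim!: nonpos_Ints_cases)
  have L: "L = ln (norm w) - ln (2 * pi)" using nw by (simp add: L_def ln_div)
  have "ln ((Re w)\<^sup>2 + (Im w)\<^sup>2) = 2 * ln (norm w)"
    using nw by (simp flip: cmod_power2 add: ln_realpow)
  then have "stirling_re (Re w) (Im w) = (Re w - 1/2) * ln (norm w) - Im w * arctan (Im w / Re w) - Re w"
    by (simp add: stirling_re_def)
  with ln_norm_Gamma_ge[OF w]
  have "(Re w - 1/2) * ln (norm w) - Im w * arctan (Im w / Re w) - Re w - 1 \<le> ln (norm (Gamma w))"
    by simp
  moreover have "(Re w - 1/2) * ln (norm w) - Im w * arctan (Im w / Re w) - Re w - 1 =
      (Re w * (L - 1) - 2 * Im w * \<alpha> - 1) - ln (norm w) / 2 + Re w * ln (2 * pi) + pi * Im w / 2"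
    by (simp add: L \<alpha>_def field_simps)
  ultimately have "(Re w * (L - 1) - 2 * Im w * \<alpha> - 1) - ln (norm w) / 2 \<le>
      ln (norm (Gamma w)) + - Re w * ln (2 * pi) + - (pi * Im w / 2)"
    by linarith
  then have "exp ((Re w * (L - 1) - 2 * Im w * \<alpha> - 1) - ln (norm w) / 2) \<le>
      exp (ln (norm (Gamma w)) + - Re w * ln (2 * pi) + - (pi * Im w / 2))"
    by simp
  moreover have "exp (ln (norm w) / 2) = sqrt (norm w)"
    using nw by (simp add: ln_sqrt[symmetric])
  ultimately show ?thesis
    using nz by (simp only: exp_diff exp_add exp_ln) (simp add: powr_def)
qed

subsection \<open>Integrals along the saddle ray\<close>

text \<open>With v = 2 pi \<rho>^2 / r this is ln v <= v - 1, sharp at the saddle radius v = 1. The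
  inequality is multiplied by x - 1 only, which saves one Gaussian factor for convergence along the
  ray.\<close>

lemma powr_gauss_le:
  fixes \<rho> r x :: real
  assumes \<rho>: "\<rho> > 0" and r: "r > 0" and x: "x \<ge> 1"
  shows "\<rho> powr (x - 1) * exp (- (pi * \<rho>\<^sup>2 * (x / r))) \<le>
    exp ((x - 1) * (ln (r / (2 * pi)) - 1) / 2) * exp (- (pi * \<rho>\<^sup>2 / r))"
proof -
  define v where "v = 2 * pi * \<rho>\<^sup>2 / r"
  have v: "v > 0" using \<rho> r by (simp add: v_def)
  have "ln v = 2 * ln \<rho> - ln (r / (2 * pi))"
    using \<rho> r by (simp add: v_def ln_div ln_mult ln_realpow)
  then have "2 * ln \<rho> - ln (r / (2 * pi)) \<le> v - 1"
    using ln_le_minus_one[OF v] by simp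
  then have "ln \<rho> - v / 2 \<le> (ln (r / (2 * pi)) - 1) / 2" by argo
  then have "(x - 1) * (ln \<rho> - v / 2) \<le> (x - 1) * ((ln (r / (2 * pi)) - 1) / 2)"
    using x by (intro mult_left_mono) auto
  moreover have "(x - 1) * (ln \<rho> - v / 2) = (x - 1) * ln \<rho> - v / 2 * x + v / 2"
    by (simp only: left_diff_distrib right_diff_distrib) simp
  moreover have "pi * \<rho>\<^sup>2 * (x / r) = v / 2 * x" "pi * \<rho>\<^sup>2 / r = v / 2" by (simp_all add: v_def)
  ultimately have "(x - 1) * ln \<rho> - pi * \<rho>\<^sup>2 * (x / r) \<le>
      (x - 1) * (ln (r / (2 * pi)) - 1) / 2 - pi * \<rho>\<^sup>2 / r"
    by simp
  then show ?thesis using \<rho> by (simp add: powr_def flip: exp_add)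
qed

text \<open>An exponential at scale sqrt r has an explicit primitive and sums geometrically over
  cells. The proof needs only pi >= 1 and v <= 1 + v^2.\<close>

lemma gauss_le_exp:
  fixes \<rho> r :: real
  assumes "\<rho> > 0" "r > 0"
  shows "exp (- (pi * \<rho>\<^sup>2 / r)) \<le> exp 1 * exp (- (\<rho> / sqrt r))"
proof -
  define v where "v = \<rho> / sqrt r"
  have v: "v > 0" "v\<^sup>2 = \<rho>\<^sup>2 / r" using assms by (auto simp: v_def power_divide)
  have "1 * v\<^sup>2 \<le> pi * v\<^sup>2" using pi_gt3 by (intro mult_right_mono) auto
  moreover have "0 \<le> (v - 1/2)\<^sup>2" by simp
  then have "v \<le> 1 + v\<^sup>2" by (simp add: power2_eq_square algebra_simps)
  ultimately have "- (pi * v\<^sup>2) \<le> 1 + - v" by linarith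
  then have "exp (- (pi * v\<^sup>2)) \<le> exp 1 * exp (- v)" by (simp flip: exp_add)
  then show ?thesis using v by (simp add: v_def)
qed

lemma Ln_ray:
  assumes "\<rho> > 0" "0 < \<alpha>" "\<alpha> < pi"
  shows "Ln (of_real \<rho> * cis \<alpha>) = of_real (ln \<rho>) + \<i> * of_real \<alpha>"
  using assms by (intro Ln_unique) (auto simp: exp_add cis_conv_exp exp_of_real)

lemma norm_power_ray:
  assumes "\<rho> > 0" "0 < \<alpha>" "\<alpha> < pi"
  shows "norm (exp (- s * Ln (of_real \<rho> * cis \<alpha>))) = \<rho> powr (- Re s) * exp (Im s * \<alpha>)"
  using assms by (simp add: Ln_ray powr_def flip: exp_add)

lemma norm_integrand_ray:
  assumes \<rho>: "\<rho> > 0" and \<alpha>: "0 < \<alpha>" "\<alpha> < pi"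
  shows "norm (riemann_aux_integrand s (of_real \<rho> * cis \<alpha>)) =
    exp (Im s * \<alpha>) * (\<rho> powr (- Re s) * exp (- (pi * \<rho>\<^sup>2 * sin (2 * \<alpha>)))) /
      norm (sin_denom (of_real \<rho> * cis \<alpha>))"
proof -
  define u where "u = of_real \<rho> * cis \<alpha>"
  have "u \<noteq> 0" "norm u = \<rho>" "Im (Ln u) = \<alpha>" "Re u = \<rho> * cos \<alpha>" "Im u = \<rho> * sin \<alpha>"
    using \<rho> Ln_ray[OF \<rho> \<alpha>] by (auto simp: u_def norm_mult)
  then show ?thesis
    unfolding u_def[symmetric] sin_double by (simp add: norm_integrand power2_eq_square mult_ac)
qed

text \<open>The angle \<open>\<alpha> = \<pi>/4 + arg w / 2\<close> is that of the saddle point of \<open>u\<^sup>w e\<^bsup>\<pi> i u\<^sup>2\<^esup>\<close>.\<close>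

lemma sin_saddle_angle:
  fixes w :: complex
  assumes "Re w > 0"
  shows "sin (2 * (pi / 4 + arctan (Im w / Re w) / 2)) = Re w / norm w"
proof -
  have "sin (2 * (pi / 4 + arctan (Im w / Re w) / 2)) = cos (arctan (Im w / Re w))"
    by (simp add: algebra_simps sin_add)
  also have "\<dots> = 1 / sqrt (1 + (Im w / Re w)\<^sup>2)" by (rule cos_arctan)
  also have "1 + (Im w / Re w)\<^sup>2 = (norm w / Re w)\<^sup>2"
    using assms by (simp add: cmod_power2 power_divide field_simps)
  also have "sqrt \<dots> = norm w / Re w" using assms by simp
  finally show ?thesis by simp
qed

lemma saddle_angle_bounds:
  fixes w :: complex
  shows "0 < pi / 4 + arctan (Im w / Re w) / 2" "pi / 4 + arctan (Im w / Re w) / 2 < pi / 2"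
  using arctan_bounded[of "Im w / Re w"] by auto

text \<open>At the saddle angle sin (2 \<alpha>) = Re w / |w|, so the Gaussian on the ray is the one
  in \<open>powr_gauss_le\<close>.\<close>

lemma norm_integrand_saddle_ray_le:
  fixes s w :: complex
  assumes \<rho>: "\<rho> > 0" and w: "1 \<le> Re w" "s = 1 - w"
  defines "L \<equiv> ln (norm w / (2 * pi))" and "\<alpha> \<equiv> pi / 4 + arctan (Im w / Re w) / 2"
  shows "norm (riemann_aux_integrand s (of_real \<rho> * cis \<alpha>)) \<le>
    exp (- Im w * \<alpha>) * exp ((Re w - 1) * (L - 1) / 2) * exp 1 * exp (- (\<rho> / sqrt (norm w))) /
      norm (sin_denom (of_real \<rho> * cis \<alpha>))"
proof -
  have \<alpha>: "0 < \<alpha>" "\<alpha> < pi" using saddle_angle_bounds[of w] unfolding \<alpha>_def by linarith+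
  have r: "norm w > 0" using w by auto
  have "\<rho> powr (Re w - 1) * exp (- (pi * \<rho>\<^sup>2 * (Re w / norm w))) \<le>
      exp ((Re w - 1) * (L - 1) / 2) * exp (- (pi * \<rho>\<^sup>2 / norm w))"
    unfolding L_def by (rule powr_gauss_le) (use \<rho> r w in auto)
  also have "\<dots> \<le> exp ((Re w - 1) * (L - 1) / 2) * (exp 1 * exp (- (\<rho> / sqrt (norm w))))"
    by (intro mult_left_mono gauss_le_exp \<rho> r) auto
  finally have "exp (- Im w * \<alpha>) * (\<rho> powr (Re w - 1) * exp (- (pi * \<rho>\<^sup>2 * (Re w / norm w)))) \<le>
      exp (- Im w * \<alpha>) * (exp ((Re w - 1) * (L - 1) / 2) * (exp 1 * exp (- (\<rho> / sqrt (norm w)))))"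
    by (intro mult_left_mono) auto
  moreover have "sin (2 * \<alpha>) = Re w / norm w"
    unfolding \<alpha>_def using w by (intro sin_saddle_angle) auto
  ultimately show ?thesis
    unfolding norm_integrand_ray[OF \<rho> \<alpha>] using w
    by (intro divide_right_mono) (auto simp: mult_ac)
qed

lemma has_vector_derivative_ray:
  assumes "(\<Phi> has_field_derivative f (of_real x * d)) (at (of_real x * d))"
  shows "((\<lambda>x. \<Phi> (of_real x * d)) has_vector_derivative f (of_real x * d) * d) (at x within A)"
proof -
  have "((\<lambda>x. of_real x * d) has_vector_derivative d) (at x within A)"
    by (auto intro!: derivative_eq_intros simp: scaleR_conv_of_real)
  from field_vector_diff_chain_within[OF this has_field_derivative_at_within[OF assms]]
  show ?thesis by (simp add: o_def mult.commute)
qed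

text \<open>Comparing with a primitive \<open>H\<close> of the majorant lets every estimate along a
  ray be read off from endpoint values of an explicit function.\<close>

lemma ray_diff_le:
  fixes \<Phi> :: "complex \<Rightarrow> complex"
  assumes ab: "a < b"
    and \<Phi>: "\<And>x. a \<le> x \<Longrightarrow> x \<le> b \<Longrightarrow> (\<Phi> has_field_derivative f (of_real x * d)) (at (of_real x * d))"
    and H: "\<And>x. a \<le> x \<Longrightarrow> x \<le> b \<Longrightarrow> (H has_real_derivative h x) (at x)"
    and le: "\<And>x. a \<le> x \<Longrightarrow> x \<le> b \<Longrightarrow> norm (f (of_real x * d)) * norm d \<le> h x"
  shows "norm (\<Phi> (of_real b * d) - \<Phi> (of_real a * d)) \<le> H b - H a"
proof (rule differentiable_bound_general[OF ab])
  show "continuous_on {a..b} (\<lambda>x. \<Phi> (of_real x * d))"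
    unfolding continuous_on_eq_continuous_within
    by (intro ballI has_vector_derivative_continuous[OF has_vector_derivative_ray[where f = f]] \<Phi>) auto
  show "continuous_on {a..b} H"
    using H by (auto intro!: continuous_at_imp_continuous_on DERIV_isCont)
  fix x assume x: "a < x" "x < b"
  show "((\<lambda>x. \<Phi> (of_real x * d)) has_vector_derivative f (of_real x * d) * d) (at x)"
    using \<Phi>[of x] x by (intro has_vector_derivative_ray) auto
  show "(H has_vector_derivative h x) (at x)"
    using H[of x] x by (simp add: has_real_derivative_iff_has_vector_derivative)
  show "norm (f (of_real x * d) * d) \<le> h x"
    using le[of x] x by (simp add: norm_mult)
qed

text \<open>For Im w >= 0 the angle is at least pi / 4, so the ray keeps away from the nonzero poles
  and the denominator is at least \<rho>. One exponential majorant serves \<rho> >= 1 and \<rho> < 1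
  alike, and its integral gives the factor sqrt |w|.\<close>

lemma ray_bound_upper:
  fixes s w :: complex
  assumes \<Phi>: "\<And>u. Im u > 0 \<Longrightarrow> (\<Phi> has_field_derivative riemann_aux_integrand s u) (at u)"
    and w: "2 \<le> Re w" "0 \<le> Im w" "s = 1 - w"
  defines "L \<equiv> ln (norm w / (2 * pi))" and "\<alpha> \<equiv> pi / 4 + arctan (Im w / Re w) / 2"
  assumes L: "1 \<le> L" and ab: "0 < a" "a < b"
  shows "norm (\<Phi> (of_real b * cis \<alpha>) - \<Phi> (of_real a * cis \<alpha>)) \<le>
    exp (- Im w * \<alpha>) * exp ((Re w - 1) * (L - 1) / 2) * exp 1 * sqrt (norm w)"
proof -
  define E where "E = exp (- Im w * \<alpha>)"
  define Q where "Q = exp ((Re w - 1) * (L - 1) / 2)"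
  define q where "q = sqrt (norm w)"
  have nw: "norm w \<ge> 2" using w(1) complex_Re_le_cmod[of w] by linarith
  have q: "q \<ge> 1" using nw by (simp add: q_def)
  have Q: "Q \<ge> 1" using w L by (simp add: Q_def)
  have E: "E > 0" by (simp add: E_def)
  have "0 \<le> arctan (Im w / Re w)" using w by simp
  then have \<alpha>: "pi / 4 \<le> \<alpha>" "\<alpha> < pi / 2" using saddle_angle_bounds[of w] by (auto simp: \<alpha>_def)
  have "sin (pi / 6) \<le> sin \<alpha>" using \<alpha> pi_gt3 by (subst sin_mono_le_eq) auto
  then have sin\<alpha>: "1/2 \<le> sin \<alpha>" by (simp add: sin_30)
  define H where "H = (\<lambda>\<rho>. - (E * Q * exp 1 * q * exp (- (\<rho> / q))))"
  have "norm (\<Phi> (of_real b * cis \<alpha>) - \<Phi> (of_real a * cis \<alpha>)) \<le> H b - H a"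
  proof (rule ray_diff_le[OF ab(2)])
    fix \<rho> assume "a \<le> \<rho>" "\<rho> \<le> b"
    then have \<rho>: "\<rho> > 0" using ab by simp
    have Im: "Im (of_real \<rho> * cis \<alpha>) = \<rho> * sin \<alpha>" by simp
    show "(\<Phi> has_field_derivative riemann_aux_integrand s (of_real \<rho> * cis \<alpha>)) (at (of_real \<rho> * cis \<alpha>))"
      by (rule \<Phi>) (use \<rho> sin\<alpha> in auto)
    show "(H has_real_derivative E * Q * exp 1 * exp (- (\<rho> / q))) (at \<rho>)"
      unfolding H_def using q by (auto intro!: derivative_eq_intros)
    have "\<rho> * 1 \<le> \<rho> * (2 * pi * sin \<alpha>)"
      using \<rho> sin\<alpha> pi_gt3 mult_mono[of 2 "2 * pi" "1/2" "sin \<alpha>"] by (intro mult_left_mono) auto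
    also have "\<dots> = 2 * pi * \<bar>Im (of_real \<rho> * cis \<alpha>)\<bar>"
      unfolding Im using \<rho> sin\<alpha> by (simp add: abs_mult)
    also have "\<dots> \<le> norm (sin_denom (of_real \<rho> * cis \<alpha>))" by (rule norm_sin_denom_ge_Im)
    finally have den: "\<rho> \<le> norm (sin_denom (of_real \<rho> * cis \<alpha>))" by simp
    show "norm (riemann_aux_integrand s (of_real \<rho> * cis \<alpha>)) * norm (cis \<alpha>) \<le> E * Q * exp 1 * exp (- (\<rho> / q))"
    proof (cases "\<rho> \<ge> 1")
      case True
      have "norm (riemann_aux_integrand s (of_real \<rho> * cis \<alpha>)) \<le>
          E * Q * exp 1 * exp (- (\<rho> / q)) / norm (sin_denom (of_real \<rho> * cis \<alpha>))"
        using norm_integrand_saddle_ray_le[OF \<rho>, of w s] w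
        by (simp add: E_def Q_def q_def L_def \<alpha>_def)
      also have "\<dots> \<le> E * Q * exp 1 * exp (- (\<rho> / q)) / 1"
        using den True E Q by (intro divide_left_mono) auto
      finally show ?thesis by simp
    next
      case False
      have "norm (riemann_aux_integrand s (of_real \<rho> * cis \<alpha>)) =
          E * (\<rho> powr (Re w - 1) * exp (- (pi * \<rho>\<^sup>2 * sin (2 * \<alpha>)))) / norm (sin_denom (of_real \<rho> * cis \<alpha>))"
        using norm_integrand_ray[OF \<rho>, of \<alpha> s] w \<alpha> pi_gt3 by (simp add: E_def)
      \<comment> \<open>Close to 0 the zero of the denominator is cancelled by a full power of
        \<rho>, available because Re w - 1 >= 1.\<close>
      also have "\<dots> \<le> E * (\<rho> powr 1 * 1) / \<rho>"
      proof (intro frac_le mult_left_mono mult_mono den \<rho>)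
        show "\<rho> powr (Re w - 1) \<le> \<rho> powr 1" using False \<rho> w by (intro powr_mono') auto
        show "exp (- (pi * \<rho>\<^sup>2 * sin (2 * \<alpha>))) \<le> 1" using \<alpha> by (auto intro!: mult_nonneg_nonneg sin_ge_zero)
      qed (use E in auto)
      also have "\<dots> = E * 1" using \<rho> by simp
      also have "\<dots> \<le> E * (Q * exp (1 - \<rho> / q))"
      proof (intro mult_left_mono)
        have "\<rho> / q \<le> 1" using False q by (simp add: divide_le_eq)
        then have "1 * 1 \<le> Q * exp (1 - \<rho> / q)" using Q by (intro mult_mono) auto
        then show "1 \<le> Q * exp (1 - \<rho> / q)" by simp
      qed (use E in auto)
      also have "\<dots> = E * Q * exp 1 * exp (- (\<rho> / q))" by (simp add: exp_diff exp_minus field_simps)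
      finally show ?thesis by simp
    qed
  qed
  also have "\<dots> \<le> E * Q * exp 1 * q * 1"
  proof -
    have "E * Q * exp 1 * q * exp (- (a / q)) \<le> E * Q * exp 1 * q * 1"
      using E Q q ab by (intro mult_left_mono) auto
    moreover have "0 \<le> E * Q * exp 1 * q * exp (- (b / q))" using E Q q by simp
    ultimately show ?thesis by (simp add: H_def)
  qed
  finally show ?thesis by (simp add: E_def Q_def q_def)
qed

text \<open>
  Parametrised by its real part, the saddle ray \<open>u = x (1 + i \<eta>)\<close> with \<open>\<eta> \<ge> 1 / (2 \<bar>w\<bar>)\<close> passes the
  pole \<open>n\<close> at distance about \<open>n \<eta>\<close>; integrating \<open>1 / (\<bar>x - n\<bar> + \<eta>)\<close> over the cell is the source of
  the factor \<open>log \<bar>s\<bar>\<close>.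
\<close>

lemma ray_bound_cell:
  fixes s w :: complex and n :: nat
  assumes \<Phi>: "\<And>u. Im u > 0 \<Longrightarrow> (\<Phi> has_field_derivative riemann_aux_integrand s u) (at u)"
    and w: "1 \<le> Re w" "Im w < 0" "s = 1 - w"
  defines "L \<equiv> ln (norm w / (2 * pi))" and "\<alpha> \<equiv> pi / 4 + arctan (Im w / Re w) / 2"
  defines "d \<equiv> of_real (1 / cos \<alpha>) * cis \<alpha>"
  assumes n: "1 \<le> n" and r: "2 \<le> norm w"
  shows "norm (\<Phi> (of_real (real n + 1/2) * d) - \<Phi> (of_real (real n - 1/2) * d)) \<le>
    exp (- Im w * \<alpha>) * exp ((Re w - 1) * (L - 1) / 2) * (6 * exp 1) * ln (norm w) *
      exp (- ((real n - 1/2) / sqrt (norm w)))"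
proof -
  define E where "E = exp (- Im w * \<alpha>)"
  define Q where "Q = exp ((Re w - 1) * (L - 1) / 2)"
  define q where "q = sqrt (norm w)"
  define \<eta> where "\<eta> = tan \<alpha>"
  \<comment> \<open>The factor 3/2 bounds \<open>norm d\<close>: the angle is below pi / 4, and 1 /
    cos \<alpha> <= sqrt 2 < 3/2.\<close>
  define K where "K = E * Q * exp 1 * exp (- ((real n - 1/2) / q)) * (3/2)"
  have K: "K > 0" by (simp add: K_def E_def Q_def)
  have q: "q > 0" unfolding q_def using r by (intro real_sqrt_gt_zero) linarith
  have "arctan (Im w / Re w) < 0" using w by (simp add: divide_neg_pos)
  then have \<alpha>: "0 < \<alpha>" "\<alpha> < pi / 4" using saddle_angle_bounds[of w] by (auto simp: \<alpha>_def)
  have cos1: "cos \<alpha> \<le> 1" by simp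
  have "cos (pi / 4) \<le> cos \<alpha>" using \<alpha> by (intro cos_monotone_0_pi_le) auto
  moreover have "2/3 \<le> sqrt 2 / 2" by (rule power2_le_imp_le) (auto simp: power2_eq_square)
  ultimately have cos: "2/3 \<le> cos \<alpha>" by (simp add: cos_45)
  have sin: "sin \<alpha> > 0" using \<alpha> pi_gt3 by (intro sin_gt_zero) auto
  have "norm d = 1 / cos \<alpha>" using cos by (simp add: d_def norm_mult norm_divide)
  also have "\<dots> \<le> 1 / (2/3)" using cos by (intro divide_left_mono) auto
  finally have nd: "norm d \<le> 3/2" by simp
  have \<eta>: "\<eta> > 0" using sin cos by (simp add: \<eta>_def tan_def)
  have Re: "Re (of_real x * d) = x" and Im: "Im (of_real x * d) = x * \<eta>" for x
    using cos by (auto simp: d_def \<eta>_def tan_def)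
  \<comment> \<open>From sin (2 \<alpha>) = Re w / |w| >= 1 / |w| and tan \<alpha> >= sin \<alpha>
    cos \<alpha>.\<close>
  have \<eta>_ge: "1 / (2 * norm w) \<le> \<eta>"
  proof -
    have "1 / norm w / 2 \<le> Re w / norm w / 2" using w by (intro divide_right_mono) auto
    then have "1 / (2 * norm w) \<le> Re w / norm w / 2" by (simp add: mult.commute)
    also have "\<dots> = sin (2 * \<alpha>) / 2" using sin_saddle_angle[of w] w by (simp add: \<alpha>_def)
    also have "\<dots> = sin \<alpha> * cos \<alpha>" by (simp add: sin_double)
    also have "\<dots> \<le> sin \<alpha> * 1" using sin cos1 by (intro mult_left_mono) auto
    also have "\<dots> \<le> sin \<alpha> / cos \<alpha>" using sin cos cos1 by (simp add: le_divide_eq)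
    finally show ?thesis by (simp add: \<eta>_def tan_def)
  qed
  have deriv: "(\<Phi> has_field_derivative riemann_aux_integrand s (of_real x * d)) (at (of_real x * d))"
    if "x > 0" for x
    by (rule \<Phi>) (use that \<eta> Im[of x] in simp)
  have le: "norm (riemann_aux_integrand s (of_real x * d)) * norm d \<le> K / (\<bar>x - real n\<bar> + \<eta>)"
    if x: "\<bar>x - real n\<bar> \<le> 1/2" for x
  proof -
    define u where "u = of_real x * d"
    have x0: "x \<ge> 1/2" "x \<ge> real n - 1/2" using x n by linarith+
    have u: "u = of_real (x / cos \<alpha>) * cis \<alpha>" by (simp add: u_def d_def)
    have "x \<le> x / cos \<alpha>" using x0 cos cos1 by (simp add: le_divide_eq)
    then have "real n - 1/2 \<le> x / cos \<alpha>" using x0 by linarith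
    then have "(real n - 1/2) / q \<le> x / cos \<alpha> / q" using q by (intro divide_right_mono) auto
    then have "exp (- (x / cos \<alpha> / q)) \<le> exp (- ((real n - 1/2) / q))"
      by (simp only: exp_le_cancel_iff neg_le_iff_le)
    then have 1: "E * Q * exp 1 * exp (- (x / cos \<alpha> / q)) \<le> E * Q * exp 1 * exp (- ((real n - 1/2) / q))"
      by (intro mult_left_mono) (auto simp: E_def Q_def)
    have Re_u: "Re u = x" and Im_u: "Im u = x * \<eta>" unfolding u_def by (rule Re, rule Im)
    have "4 * \<bar>x - real n\<bar> \<le> norm (sin_denom u)"
      using norm_sin_denom_ge_Re[of u "int n"] x by (simp add: Re_u)
    moreover have "3 * \<eta> \<le> 2 * pi * (x * \<eta>)"
    proof -
      have "3 * \<eta> \<le> (2 * pi * x) * \<eta>"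
        using pi_gt3 x0 \<eta> mult_mono[of 6 "2 * pi" "1/2" x] by (intro mult_right_mono) auto
      then show ?thesis by (simp add: mult_ac)
    qed
    moreover have "2 * pi * (x * \<eta>) \<le> norm (sin_denom u)"
      using norm_sin_denom_ge_Im[of u] x0 \<eta> by (simp add: Im_u abs_mult)
    ultimately have "4 * \<bar>x - real n\<bar> \<le> norm (sin_denom u)" "3 * \<eta> \<le> norm (sin_denom u)"
      by (blast intro: order_trans)+
    moreover have "a + b \<le> c" if "4 * a \<le> c" "3 * b \<le> c" "0 < b" for a b c :: real
      using that by argo
    ultimately have den: "\<bar>x - real n\<bar> + \<eta> \<le> norm (sin_denom u)" using \<eta> by blast
    have pos: "0 < \<bar>x - real n\<bar> + \<eta>" using \<eta> by linarith
    have "norm (riemann_aux_integrand s u) \<le>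
        E * Q * exp 1 * exp (- (x / cos \<alpha> / q)) / norm (sin_denom u)"
      using norm_integrand_saddle_ray_le[of "x / cos \<alpha>" w s] w x0 cos
      by (simp add: E_def Q_def q_def L_def \<alpha>_def u)
    also have "\<dots> \<le> E * Q * exp 1 * exp (- ((real n - 1/2) / q)) / (\<bar>x - real n\<bar> + \<eta>)"
      using 1 den pos by (intro frac_le) (auto simp: E_def Q_def)
    finally have "norm (riemann_aux_integrand s u) * norm d \<le>
        E * Q * exp 1 * exp (- ((real n - 1/2) / q)) / (\<bar>x - real n\<bar> + \<eta>) * (3/2)"
      using nd pos by (intro mult_mono) (auto simp: E_def Q_def)
    then show ?thesis unfolding K_def u_def by (simp only: times_divide_eq_left)
  qed
  have nn: "real n \<ge> 1" using n by simp
  \<comment> \<open>The majorant has a kink at the pole, so the cell is cut at \<open>n\<close>;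
    each half has a logarithm as primitive.\<close>
  have right: "norm (\<Phi> (of_real (real n + 1/2) * d) - \<Phi> (of_real (real n) * d)) \<le>
      K * ln (\<eta> + ((real n + 1/2) - real n)) - K * ln (\<eta> + (real n - real n))"
  proof (rule ray_diff_le[where f = "riemann_aux_integrand s" and H = "\<lambda>x. K * ln (\<eta> + (x - real n))"])
    fix x assume x: "real n \<le> x" "x \<le> real n + 1/2"
    show "((\<lambda>x. K * ln (\<eta> + (x - real n))) has_real_derivative K / (\<eta> + (x - real n))) (at x)"
      using x \<eta> by (auto intro!: derivative_eq_intros)
    show "norm (riemann_aux_integrand s (of_real x * d)) * norm d \<le> K / (\<eta> + (x - real n))"
      using le[of x] x by (simp add: add_ac)
  qed (use deriv nn in auto)
  have left: "norm (\<Phi> (of_real (real n) * d) - \<Phi> (of_real (real n - 1/2) * d)) \<le>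
      - (K * ln (\<eta> + (real n - real n))) - - (K * ln (\<eta> + (real n - (real n - 1/2))))"
  proof (rule ray_diff_le[where f = "riemann_aux_integrand s" and H = "\<lambda>x. - (K * ln (\<eta> + (real n - x)))"])
    fix x assume x: "real n - 1/2 \<le> x" "x \<le> real n"
    show "((\<lambda>x. - (K * ln (\<eta> + (real n - x)))) has_real_derivative K / (\<eta> + (real n - x))) (at x)"
      using x \<eta> by (auto intro!: derivative_eq_intros)
    show "norm (riemann_aux_integrand s (of_real x * d)) * norm d \<le> K / (\<eta> + (real n - x))"
      using le[of x] x by (simp add: add_ac)
  qed (use deriv nn in auto)
  \<comment> \<open>The lower bound on \<eta> gives 1 + 1 / (2 \<eta>) <= 1 + |w| <= |w|^2, hence 2
    ln |w| for each half cell. Two halves and the 3/2 inside \<open>K\<close> make the constant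
    6.\<close>
  have "ln (\<eta> + 1/2) - ln \<eta> = ln (1 + 1 / (2 * \<eta>))"
  proof -
    have "1 + 1 / (2 * \<eta>) = (\<eta> + 1/2) / \<eta>" using \<eta> by (simp add: field_simps)
    then show ?thesis using \<eta> by (simp add: ln_div del: add_divide_distrib)
  qed
  also have "\<dots> \<le> ln (norm w * norm w)"
  proof (subst ln_le_cancel_iff)
    have "0 < norm w" using r by linarith
    then have "1 / (2 * \<eta>) \<le> norm w" using \<eta>_ge \<eta> by (simp add: field_simps)
    moreover have "1 + norm w \<le> norm w * 2" using r by simp
    moreover have "norm w * 2 \<le> norm w * norm w" using r by (intro mult_left_mono) auto
    ultimately show "1 + 1 / (2 * \<eta>) \<le> norm w * norm w" by linarith
  qed (use \<eta> r in \<open>auto intro!: add_pos_pos mult_pos_pos\<close>)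
  also have "\<dots> = 2 * ln (norm w)" using r by (subst ln_mult) auto
  finally have lnb: "2 * K * (ln (\<eta> + 1/2) - ln \<eta>) \<le> 2 * K * (2 * ln (norm w))"
    using K by (intro mult_left_mono) auto
  have "norm (\<Phi> (of_real (real n + 1/2) * d) - \<Phi> (of_real (real n - 1/2) * d)) \<le>
      norm (\<Phi> (of_real (real n + 1/2) * d) - \<Phi> (of_real (real n) * d)) +
      norm (\<Phi> (of_real (real n) * d) - \<Phi> (of_real (real n - 1/2) * d))"
    by (metis dist_norm dist_triangle)
  also have "\<dots> \<le> 2 * K * (ln (\<eta> + 1/2) - ln \<eta>)"
    using left right by (simp add: algebra_simps)
  also note lnb
  also have "2 * K * (2 * ln (norm w)) = E * Q * (6 * exp 1) * ln (norm w) * exp (- ((real n - 1/2) / q))"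
    by (simp add: K_def)
  finally show ?thesis by (simp add: E_def Q_def q_def)
qed

text \<open>A geometric series with ratio z = exp (- 1 / q); the inequality exp (1 / q) >= 1 + 1 / q
  gives 1 / (1 - z) <= 1 + q <= 2 q.\<close>

lemma sum_exp_le:
  fixes q :: real
  assumes q: "q \<ge> 1"
  shows "(\<Sum>k<N. exp (- ((real k + 1/2) / q))) \<le> 2 * q"
proof -
  define z where "z = exp (- (1 / q))"
  have z: "0 < z" "z < 1" using q by (auto simp: z_def)
  have "(\<Sum>k<N. exp (- ((real k + 1/2) / q))) \<le> (\<Sum>k<N. z ^ k)"
  proof (rule sum_mono)
    fix k
    have "exp (- ((real k + 1/2) / q)) \<le> exp (- (real k / q))"
      using q by (simp add: divide_right_mono)
    also have "\<dots> = z ^ k" by (simp add: z_def flip: exp_of_nat_mult)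
    finally show "exp (- ((real k + 1/2) / q)) \<le> z ^ k" .
  qed
  also have "\<dots> = (1 - z ^ N) / (1 - z)" using z by (simp add: sum_gp_strict)
  also have "\<dots> \<le> 1 / (1 - z)" using z by (intro divide_right_mono) auto
  also have "1 / (1 - z) \<le> 1 + q"
  proof -
    have "1 + 1 / q \<le> exp (1 / q)" by (rule exp_ge_add_one_self)
    then have "z * (1 + 1 / q) \<le> z * exp (1 / q)" using z by (intro mult_left_mono) auto
    also have "z * exp (1 / q) = 1" by (simp add: z_def flip: exp_add)
    finally have "z * q + z \<le> q" using q by (simp add: field_simps)
    then show ?thesis using z by (simp add: field_simps)
  qed
  finally show ?thesis using q by simp
qed

text \<open>Subtracting the polar part at 0 leaves a quotient whose denominator has exact order
  |u|^2. Taylor remainders bound the numerator to that same order.\<close>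

lemma integrand_pole_bounded:
  assumes u: "u \<noteq> 0" "\<bar>Re u\<bar> \<le> 1/2" "norm u \<le> 1"
  shows "norm (exp (of_real pi * \<i> * u\<^sup>2) / sin_denom u - 1 / (2 * of_real pi * \<i> * u)) \<le> pi * exp pi"
proof -
  define z where "z = of_real pi * \<i> * u"
  have nz: "norm z = pi * norm u" "norm z \<le> pi" using u by (simp_all add: z_def norm_mult)
  have nu: "norm u > 0" using u by simp
  have den: "4 * norm u \<le> norm (sin_denom u)" by (rule norm_sin_denom_ge_norm) fact
  then have den0: "sin_denom u \<noteq> 0" using u by auto
  have ez: "norm (exp v - 1 - v) \<le> exp pi * (norm v)\<^sup>2" if "norm v \<le> pi" for v :: complex
  proof -
    have "norm (exp v - (\<Sum>i\<le>1. v ^ i / fact i)) \<le> exp (norm v) * norm v ^ Suc 1 / fact 1"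
      by (rule Taylor_exp_field)
    also have "\<dots> \<le> exp pi * (norm v)\<^sup>2"
      using that by (auto simp: power2_eq_square intro!: mult_right_mono)
    finally show ?thesis by (simp add: algebra_simps)
  qed
  have e1: "norm (exp v - 1) \<le> exp pi * norm v" if "norm v \<le> pi" for v :: complex
  proof -
    have "norm (exp v - (\<Sum>i\<le>0. v ^ i / fact i)) \<le> exp (norm v) * norm v ^ Suc 0 / fact 0"
      by (rule Taylor_exp_field)
    also have "\<dots> \<le> exp pi * norm v"
      using that by (auto intro!: mult_right_mono)
    finally show ?thesis by simp
  qed
  have "norm (sin_denom u - 2 * z) = norm ((exp z - 1 - z) - (exp (- z) - 1 - (- z)))"
  proof -
    have "sin_denom u = exp z - exp (- z)" by (simp add: sin_denom_def z_def)
    then show ?thesis by (intro arg_cong[of _ _ norm]) simp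
  qed
  also have "\<dots> \<le> exp pi * (norm z)\<^sup>2 + exp pi * (norm (- z))\<^sup>2"
    using nz by (intro norm_triangle_le_diff add_mono ez) auto
  finally have 1: "norm (sin_denom u - 2 * z) \<le> 2 * pi\<^sup>2 * exp pi * (norm u)\<^sup>2"
    using nz by (simp add: power_mult_distrib mult_ac)
  have uu: "norm u ^ 2 \<le> 1" using u power_le_one[of "norm u" 2] by simp
  have "norm (exp (of_real pi * \<i> * u\<^sup>2) - 1) \<le> exp pi * norm (of_real pi * \<i> * u\<^sup>2)"
    using uu by (intro e1) (simp add: norm_mult norm_power)
  then have "norm (2 * z * (exp (of_real pi * \<i> * u\<^sup>2) - 1)) \<le> 2 * norm z * (exp pi * norm (of_real pi * \<i> * u\<^sup>2))"
    unfolding norm_mult[of "2 * z"] norm_mult[of 2] by (intro mult_mono) auto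
  also have "\<dots> = (2 * pi\<^sup>2 * exp pi * (norm u)\<^sup>2) * norm u"
    using nz by (simp add: norm_mult norm_power power2_eq_square)
  also have "\<dots> \<le> (2 * pi\<^sup>2 * exp pi * (norm u)\<^sup>2) * 1"
    using u by (intro mult_left_mono) auto
  finally have 2: "norm (2 * z * (exp (of_real pi * \<i> * u\<^sup>2) - 1)) \<le> 2 * pi\<^sup>2 * exp pi * (norm u)\<^sup>2"
    by simp
  have z0: "z \<noteq> 0" using u by (simp add: z_def)
  have "exp (of_real pi * \<i> * u\<^sup>2) / sin_denom u - 1 / (2 * z) =
      (2 * z * (exp (of_real pi * \<i> * u\<^sup>2) - 1) - (sin_denom u - 2 * z)) / (2 * z * sin_denom u)"
    using den0 z0 by (simp add: diff_frac_eq algebra_simps)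
  also have "norm \<dots> \<le> (4 * pi\<^sup>2 * exp pi * (norm u)\<^sup>2) / (2 * (pi * norm u) * (4 * norm u))"
    unfolding norm_divide
  proof (intro frac_le)
    show "norm (2 * z * (exp (of_real pi * \<i> * u\<^sup>2) - 1) - (sin_denom u - 2 * z)) \<le> 4 * pi\<^sup>2 * exp pi * (norm u)\<^sup>2"
      using norm_triangle_ineq4[of "2 * z * (exp (of_real pi * \<i> * u\<^sup>2) - 1)" "sin_denom u - 2 * z"] 1 2
      by linarith
    show "2 * (pi * norm u) * (4 * norm u) \<le> norm (2 * z * sin_denom u)"
      unfolding norm_mult nz(1) using den by (intro mult_mono) auto
  qed (use nu in auto)
  also have "\<dots> = pi * exp pi / 2" using nu by (simp add: power2_eq_square field_simps)
  also have "\<dots> \<le> pi * exp pi" by simp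
  finally show ?thesis by (simp add: z_def mult_ac)
qed

text \<open>
  On \<open>\<bar>u\<bar> < 1\<close> a bound by absolute values costs a factor \<open>1 / (Re w - 1)\<close>, which is not uniform as
  \<open>Re s\<close> tends to \<open>0\<close>.  The integral of the polar part \<open>u\<^bsup>w-2\<^esup> / (2 \<pi> i)\<close> is therefore computed
  exactly; it has the harmless denominator \<open>\<bar>w - 1\<bar>\<close>.
\<close>

lemma ray_bound_near_0:
  fixes s w :: complex
  assumes \<Phi>: "\<And>u. Im u > 0 \<Longrightarrow> (\<Phi> has_field_derivative riemann_aux_integrand s u) (at u)"
    and w: "1 \<le> Re w" "Im w < 0" "s = 1 - w" and s: "1 \<le> norm s"
  defines "\<alpha> \<equiv> pi / 4 + arctan (Im w / Re w) / 2"
  defines "d \<equiv> of_real (1 / cos \<alpha>) * cis \<alpha>"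
  assumes \<epsilon>: "0 < \<epsilon>" "\<epsilon> < 1/2"
  shows "norm (\<Phi> (of_real (1/2) * d) - \<Phi> (of_real \<epsilon> * d)) \<le> exp (- Im w * \<alpha>) * (pi * exp pi + 1)"
proof -
  define E where "E = exp (- Im w * \<alpha>)"
  have E: "E > 0" by (simp add: E_def)
  have "arctan (Im w / Re w) < 0" using w by (simp add: divide_neg_pos)
  then have \<alpha>: "0 < \<alpha>" "\<alpha> < pi / 4" using saddle_angle_bounds[of w] by (auto simp: \<alpha>_def)
  have "cos (pi / 4) \<le> cos \<alpha>" using \<alpha> by (intro cos_monotone_0_pi_le) auto
  moreover have "2/3 \<le> sqrt 2 / 2" by (rule power2_le_imp_le) (auto simp: power2_eq_square)
  ultimately have cos: "2/3 \<le> cos \<alpha>" by (simp add: cos_45)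
  have sin: "sin \<alpha> > 0" using \<alpha> pi_gt3 by (intro sin_gt_zero) auto
  have "norm d = 1 / cos \<alpha>" using cos by (simp add: d_def norm_mult norm_divide)
  also have "\<dots> \<le> 1 / (2/3)" using cos by (intro divide_left_mono) auto
  finally have nd: "norm d \<le> 3/2" by simp
  have Re: "Re (of_real x * d) = x" and Im: "x > 0 \<Longrightarrow> Im (of_real x * d) > 0" for x
    using cos sin by (auto simp: d_def)
  have pw: "norm (exp (- s * Ln (of_real x * d))) \<le> E" if x: "0 < x" "x \<le> 1/2" for x
  proof -
    have "x / cos \<alpha> \<le> 1" "x / cos \<alpha> > 0" using x cos by (auto simp: field_simps)
    moreover have "of_real x * d = of_real (x / cos \<alpha>) * cis \<alpha>" by (simp add: d_def)
    ultimately have "norm (exp (- s * Ln (of_real x * d))) = (x / cos \<alpha>) powr (Re w - 1) * E"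
      using norm_power_ray[of "x / cos \<alpha>" \<alpha> s] \<alpha> w pi_gt3 by (simp add: E_def)
    moreover have "(x / cos \<alpha>) powr (Re w - 1) \<le> 1"
      using \<open>x / cos \<alpha> \<le> 1\<close> \<open>x / cos \<alpha> > 0\<close> w by (intro powr_le1) auto
    ultimately show ?thesis using E by simp
  qed
  have s0: "s \<noteq> 0" using s by auto
  \<comment> \<open>\<open>P\<close> is a primitive of the polar part, with - s = w - 1 in its
    denominator; |s| >= 1 keeps its norm below E / 6.\<close>
  define P where "P = (\<lambda>u. exp (- s * Ln u) / (- s * (2 * of_real pi * \<i>)))"
  define h where "h = (\<lambda>u. exp (of_real pi * \<i> * u\<^sup>2) / sin_denom u - 1 / (2 * of_real pi * \<i> * u))"
  have nP: "norm (P (of_real x * d)) \<le> E / 6" if "0 < x" "x \<le> 1/2" for x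
  proof -
    have "norm (P (of_real x * d)) = norm (exp (- s * Ln (of_real x * d))) / (norm s * (2 * pi))"
      by (simp add: P_def norm_divide norm_mult)
    also have "\<dots> \<le> E / (1 * 6)"
      using s pi_gt3 pw[OF that] E by (intro frac_le mult_mono) auto
    finally show ?thesis by simp
  qed
  have "norm ((\<Phi> (of_real (1/2) * d) - P (of_real (1/2) * d)) - (\<Phi> (of_real \<epsilon> * d) - P (of_real \<epsilon> * d))) \<le>
      E * (pi * exp pi) * (3/2) * (1/2) - E * (pi * exp pi) * (3/2) * \<epsilon>"
  proof (rule ray_diff_le[where \<Phi> = "\<lambda>u. \<Phi> u - P u" and H = "\<lambda>x. E * (pi * exp pi) * (3/2) * x"
        and f = "\<lambda>u. exp (- s * Ln u) * h u"])
    fix x assume "\<epsilon> \<le> x" "x \<le> 1/2"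
    with \<epsilon> have x: "0 < x" "x \<le> 1/2" by auto
    define u where "u = of_real x * d"
    have u: "Im u > 0" "Re u = x" using Im[of x] Re[of x] x by (auto simp: u_def)
    then have u0: "u \<noteq> 0" "u \<notin> \<real>\<^sub>\<le>\<^sub>0" by (auto simp: complex_nonpos_Reals_iff)
    have "((\<lambda>u. - s * Ln u) has_field_derivative - s * inverse u) (at u)"
      using u0 by (intro DERIV_cmult has_field_derivative_Ln)
    from DERIV_cdivide[OF DERIV_chain2[OF DERIV_exp this]]
    have "(P has_field_derivative exp (- s * Ln u) * (- s * inverse u) / (- s * (2 * of_real pi * \<i>))) (at u)"
      unfolding P_def .
    also have "exp (- s * Ln u) * (- s * inverse u) / (- s * (2 * of_real pi * \<i>)) =
        exp (- s * Ln u) * (1 / (2 * of_real pi * \<i> * u))"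
    proof -
      have "a * (- s * inverse u) / (- s * b) = a * (1 / (b * u))" for a b
        using s0 u0 by (simp add: divide_inverse mult_ac)
      then show ?thesis .
    qed
    finally have "((\<lambda>u. \<Phi> u - P u) has_field_derivative
        riemann_aux_integrand s u - exp (- s * Ln u) * (1 / (2 * of_real pi * \<i> * u))) (at u)"
      by (intro DERIV_diff \<Phi> u)
    also have "riemann_aux_integrand s u - exp (- s * Ln u) * (1 / (2 * of_real pi * \<i> * u)) =
        exp (- s * Ln u) * h u"
      by (simp add: h_def riemann_aux_integrand_def sin_denom_def right_diff_distrib)
    finally show "((\<lambda>u. \<Phi> u - P u) has_field_derivative exp (- s * Ln (of_real x * d)) * h (of_real x * d))
        (at (of_real x * d))" by (simp only: u_def)
    show "((\<lambda>x. E * (pi * exp pi) * (3/2) * x) has_real_derivative E * (pi * exp pi) * (3/2)) (at x)"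
      by (auto intro!: derivative_eq_intros)
    have "norm u \<le> 1/2 * (3/2)"
      unfolding u_def norm_mult using x nd by (intro mult_mono) auto
    then have "norm (h u) \<le> pi * exp pi"
      unfolding h_def using u0 u x by (intro integrand_pole_bounded) auto
    then show "norm (exp (- s * Ln (of_real x * d)) * h (of_real x * d)) * norm d \<le> E * (pi * exp pi) * (3/2)"
      unfolding norm_mult u_def[symmetric] using pw[OF x] nd E by (intro mult_mono) (auto simp: u_def)
  qed (use \<epsilon> in auto)
  also have "\<dots> \<le> E * (pi * exp pi) * (3/2) * (1/2)" using E \<epsilon> by simp
  also have "\<dots> = E * (pi * exp pi) * (3/4)" by simp
  also have "\<dots> \<le> E * (pi * exp pi) * 1" using E by (intro mult_left_mono) auto
  finally have "norm ((\<Phi> (of_real (1/2) * d) - P (of_real (1/2) * d)) - (\<Phi> (of_real \<epsilon> * d) - P (of_real \<epsilon> * d))) \<le>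
      E * (pi * exp pi)" by simp
  moreover have "norm (P (of_real (1/2) * d)) \<le> E / 6" by (rule nP) auto
  moreover have "norm (P (of_real \<epsilon> * d)) \<le> E / 6" using \<epsilon> by (intro nP) auto
  moreover have "norm (\<Phi> (of_real (1/2) * d) - \<Phi> (of_real \<epsilon> * d)) \<le>
      norm ((\<Phi> (of_real (1/2) * d) - P (of_real (1/2) * d)) - (\<Phi> (of_real \<epsilon> * d) - P (of_real \<epsilon> * d)))
      + (norm (P (of_real (1/2) * d)) + norm (P (of_real \<epsilon> * d)))"
    using norm_triangle_ineq[of "(\<Phi> (of_real (1/2) * d) - P (of_real (1/2) * d)) - (\<Phi> (of_real \<epsilon> * d) - P (of_real \<epsilon> * d))"
        "P (of_real (1/2) * d) - P (of_real \<epsilon> * d)"]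
      norm_triangle_ineq4[of "P (of_real (1/2) * d)" "P (of_real \<epsilon> * d)"] by simp
  ultimately have "norm (\<Phi> (of_real (1/2) * d) - \<Phi> (of_real \<epsilon> * d)) \<le> E * (pi * exp pi) + E"
    using E by linarith
  then show ?thesis by (simp add: E_def distrib_left)
qed

text \<open>The ray is cut at k + 1/2: the initial piece comes from \<open>ray_bound_near_0\<close>,
  and the cell bounds telescope into a geometric sum of at most 2 sqrt |w|. This makes the bound
  independent of \<open>N\<close> and \<epsilon>.\<close>

lemma ray_bound_lower:
  fixes s w :: complex and N :: nat
  assumes \<Phi>: "\<And>u. Im u > 0 \<Longrightarrow> (\<Phi> has_field_derivative riemann_aux_integrand s u) (at u)"
    and w: "1 \<le> Re w" "Im w < 0" "s = 1 - w" and r: "2 \<le> norm w"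
  defines "L \<equiv> ln (norm w / (2 * pi))" and "\<alpha> \<equiv> pi / 4 + arctan (Im w / Re w) / 2"
  defines "d \<equiv> of_real (1 / cos \<alpha>) * cis \<alpha>"
  assumes \<epsilon>: "0 < \<epsilon>" "\<epsilon> < 1/2"
  shows "norm (\<Phi> (of_real (real N + 1/2) * d) - \<Phi> (of_real \<epsilon> * d)) \<le>
    exp (- Im w * \<alpha>) * (pi * exp pi + 1 +
      12 * exp 1 * exp ((Re w - 1) * (L - 1) / 2) * ln (norm w) * sqrt (norm w))"
proof -
  define E where "E = exp (- Im w * \<alpha>)"
  define C where "C = E * exp ((Re w - 1) * (L - 1) / 2) * (6 * exp 1) * ln (norm w)"
  define g where "g = (\<lambda>k. \<Phi> (of_real (real k + 1/2) * d))"
  have C: "C \<ge> 0" using r by (simp add: C_def E_def)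
  have q: "sqrt (norm w) \<ge> 1" using r by simp
  have cell: "norm (g (Suc k) - g k) \<le> C * exp (- ((real k + 1/2) / sqrt (norm w)))" for k
  proof -
    have "real (Suc k) - 1/2 = real k + 1/2" by simp
    then show ?thesis
      using ray_bound_cell[of \<Phi> s w "Suc k", OF \<Phi> w] r
      unfolding g_def C_def E_def L_def \<alpha>_def d_def by (simp add: add_ac)
  qed
  have "norm (g N - g 0) = norm (\<Sum>k<N. g (Suc k) - g k)"
    by (simp add: sum_lessThan_telescope)
  also have "\<dots> \<le> (\<Sum>k<N. C * exp (- ((real k + 1/2) / sqrt (norm w))))"
    by (intro sum_norm_le cell)
  also have "\<dots> \<le> C * (2 * sqrt (norm w))"
    unfolding sum_distrib_left[symmetric] using C q by (intro mult_left_mono sum_exp_le)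
  finally have 1: "norm (g N - g 0) \<le> C * (2 * sqrt (norm w))" .
  have "norm w \<le> 1 + norm s" using w norm_triangle_ineq4[of 1 s] by simp
  then have "1 \<le> norm s" using r by simp
  from ray_bound_near_0[OF \<Phi> w this \<epsilon>]
  have 2: "norm (g 0 - \<Phi> (of_real \<epsilon> * d)) \<le> E * (pi * exp pi + 1)"
    by (simp add: g_def E_def \<alpha>_def d_def)
  have "norm (g N - \<Phi> (of_real \<epsilon> * d)) \<le> C * (2 * sqrt (norm w)) + E * (pi * exp pi + 1)"
    using 1 2 norm_triangle_ineq[of "g N - g 0" "g 0 - \<Phi> (of_real \<epsilon> * d)"] by simp
  also have "\<dots> = E * (pi * exp pi + 1 + 12 * exp 1 * exp ((Re w - 1) * (L - 1) / 2) * ln (norm w) * sqrt (norm w))"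
    by (simp add: C_def algebra_simps)
  finally show ?thesis by (simp add: g_def E_def)
qed

section \<open>Comparison with \<open>zeta_chi\<close> in the two halves of the region\<close>

lemma riemann_aux_le_zeta_chi:
  assumes c: "0 < c" "c < 1" and s: "Re s < 0"
    and \<Phi>: "\<And>u. u \<in> slit_strip \<Longrightarrow> (\<Phi> has_field_derivative riemann_aux_integrand s u) (at u)"
    and d: "Re d > 0" "Im d > 0"
    and B: "\<And>\<epsilon> n. 0 < \<epsilon> \<Longrightarrow> \<epsilon> < 1/2 \<Longrightarrow>
      norm (\<Phi> (of_real (real n + 1/2) * d) - \<Phi> (of_real \<epsilon> * d)) \<le> B"
    and w: "w = 1 - s"
  defines "L \<equiv> ln (norm w / (2 * pi))" and "\<alpha> \<equiv> pi / 4 + arctan (Im w / Re w) / 2"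
  shows "norm (riemann_aux c s) \<le>
    norm (zeta_chi s) * (B * sqrt (norm w) * exp (1 + 2 * Im w * \<alpha> - Re w * (L - 1)))"
proof -
  define T where "T = norm (Gamma w) * (2 * pi) powr (- Re w) * exp (- (pi * Im w / 2))"
  define X where "X = exp (1 + 2 * Im w * \<alpha> - Re w * (L - 1))"
  have X: "X > 0" by (simp add: X_def)
  have w1: "1 \<le> Re w" using s w by simp
  have r: "sqrt (norm w) > 0" using w1 by auto
  have B0: "B \<ge> 0" using order_trans[OF norm_ge_zero B[of "1/4" 0]] by simp
  have "exp (Re w * (L - 1) - 2 * Im w * \<alpha> - 1) * X = 1"
    by (simp add: X_def flip: exp_add)
  then have "exp (Re w * (L - 1) - 2 * Im w * \<alpha> - 1) = 1 / X"
    using X by (simp add: eq_divide_eq)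
  then have "1 / X / sqrt (norm w) \<le> T"
    using Gamma_factor_ge[OF w1] unfolding T_def L_def \<alpha>_def by simp
  then have "1 \<le> T * (sqrt (norm w) * X)" using X r by (simp add: field_simps)
  then have "B * 1 \<le> B * (T * (sqrt (norm w) * X))" using B0 by (intro mult_left_mono)
  have "norm (riemann_aux c s) \<le> norm (exp (of_real pi * \<i> * s) - 1) * B"
    using c s d \<Phi> B by (rule riemann_aux_le)
  also have "\<dots> \<le> norm (exp (of_real pi * \<i> * s) - 1) * (B * (T * (sqrt (norm w) * X)))"
    using \<open>B * 1 \<le> _\<close> by (intro mult_left_mono) auto
  \<comment> \<open>The factor exp (pi i s) - 1 is carried along on both sides and never divided by,
    so the zeros of \<open>zeta_chi\<close> are covered.\<close>
  also have "norm (zeta_chi s) = norm (exp (of_real pi * \<i> * s) - 1) * T"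
    using norm_zeta_chi[OF s] by (simp add: T_def w)
  then have "norm (exp (of_real pi * \<i> * s) - 1) * (B * (T * (sqrt (norm w) * X))) =
      norm (zeta_chi s) * (B * sqrt (norm w) * X)"
    by simp
  finally show ?thesis by (simp add: X_def)
qed

text \<open>With arg (s - 1) = pi / 2 + 2 h, the slope Im w / Re w equals - cot (2 h) = (tan h - cot
  h) / 2, and the upper edge of the region says tan h <= sqrt L.\<close>

lemma region_G_slope:
  assumes s: "s \<in> region_G" "Re s < 0" and w: "w = 1 - s"
  defines "L \<equiv> ln (norm w / (2 * pi))"
  shows "Im w \<le> Re w * (sqrt L / 2)"
proof -
  define \<theta> where "\<theta> = Arg2pi (s - 1)"
  define h where "h = (\<theta> - pi / 2) / 2"
  define r where "r = norm w"
  have nw: "norm (s - 1) = r" by (simp add: r_def w norm_minus_commute)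
  have "s - 1 = of_real r * exp (\<i> * of_real \<theta>)"
    using Arg2pi_eq[of "s - 1"] by (simp add: nw \<theta>_def)
  moreover have "w = - (s - 1)" by (simp add: w)
  ultimately have "w = - (of_real r * cis \<theta>)" by (simp only: cis_conv_exp)
  moreover have "\<theta> = 2 * h + pi / 2" by (simp add: h_def field_simps)
  ultimately have Re: "Re w = r * sin (2 * h)" and Im: "Im w = - r * cos (2 * h)"
    by (simp_all add: cos_add sin_add)
  have h: "0 \<le> h" "h \<le> arctan (sqrt L)"
    using s(1) unfolding region_G_def h_def L_def r_def[symmetric] nw[symmetric] \<theta>_def by auto
  have h2: "h < pi / 2" using h(2) arctan_ubound[of "sqrt L"] by linarith
  have c: "cos h > 0" using h h2 by (intro cos_gt_zero_pi) auto
  have tan: "tan h \<le> sqrt L"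
  proof (cases "h = arctan (sqrt L)")
    case False
    then have "tan h < tan (arctan (sqrt L))"
      using h arctan_ubound[of "sqrt L"] pi_gt3 by (intro tan_monotone) auto
    then show ?thesis by (simp add: tan_arctan)
  qed (simp add: tan_arctan)
  have "- cos (2 * h) = (sin h)\<^sup>2 - (cos h)\<^sup>2" by (simp add: cos_double)
  also have "\<dots> \<le> (sin h)\<^sup>2" by simp
  also have "\<dots> = sin (2 * h) * (tan h / 2)"
    using c by (simp add: sin_double tan_def power2_eq_square)
  finally have "r * - cos (2 * h) \<le> r * (sin (2 * h) * (tan h / 2))"
    by (rule mult_left_mono) (simp add: r_def)
  then have "Im w \<le> Re w * (tan h / 2)" by (simp add: Re Im)
  also have "\<dots> \<le> Re w * (sqrt L / 2)" using tan s(2) by (intro mult_left_mono) (auto simp: w)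
  finally show ?thesis .
qed

text \<open>Here y \<alpha> <= 0, so every exponent that arises is at most 2 - L. Since exp (- L) =
  2 pi / |w|, this cancels the two factors sqrt |w|, one from Stirling and one from the sum over
  cells; the logarithm of the cells survives.\<close>

lemma riemann_aux_bound_lower:
  assumes c: "0 < c" "c < 1" and s: "Re s < 0" and w: "w = 1 - s" and y: "Im w < 0"
    and L: "1 \<le> ln (norm w / (2 * pi))"
  shows "norm (riemann_aux c s) \<le>
    norm (zeta_chi s) * (2 * pi * exp 2 * (pi * exp pi + 1 + 12 * exp 1) * ln (norm w))"
proof -
  define \<alpha> where "\<alpha> = pi / 4 + arctan (Im w / Re w) / 2"
  define d where "d = of_real (1 / cos \<alpha>) * cis \<alpha>"
  define L where "L = ln (norm w / (2 * pi))"
  define r where "r = norm w"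
  define x where "x = Re w"
  define y where "y = Im w"
  define Q where "Q = exp ((x - 1) * (L - 1) / 2)"
  define C where "C = pi * exp pi + 1"
  have x: "1 \<le> x" using s by (simp add: x_def w)
  have r0: "r > 0" using x by (auto simp: r_def x_def)
  have L1: "1 \<le> L" using L by (simp add: L_def)
  have expL: "exp L = r / (2 * pi)" using r0 by (simp add: L_def r_def)
  have "exp 1 \<le> r / (2 * pi)" using L1 unfolding expL[symmetric] by simp
  then have "exp 1 * (2 * pi) \<le> r" by (simp add: le_divide_eq)
  moreover have "exp 1 * 1 \<le> exp 1 * (2 * pi)" using pi_gt3 by (intro mult_left_mono) auto
  ultimately have re: "exp 1 \<le> r" unfolding mult_1_right by (rule order_trans[rotated])
  moreover have "(1::real) + 1 \<le> exp 1" by (rule exp_ge_add_one_self)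
  ultimately have r2: "2 \<le> r" by linarith
  have lnr: "1 \<le> ln r" using re r0 by (subst ln_ge_iff) auto
  obtain \<Phi> where \<Phi>: "\<And>u. u \<in> slit_strip \<Longrightarrow> (\<Phi> has_field_derivative riemann_aux_integrand s u) (at u)"
    using integrand_primitive[of s] by blast
  have \<Phi>': "(\<Phi> has_field_derivative riemann_aux_integrand s u) (at u)" if "Im u > 0" for u
    using that by (intro \<Phi>) (simp add: slit_strip_def)
  have \<alpha>: "0 < \<alpha>" "\<alpha> < pi / 2" using saddle_angle_bounds[of w] by (auto simp: \<alpha>_def)
  have "cos \<alpha> > 0" "sin \<alpha> > 0" using \<alpha> by (auto intro!: cos_gt_zero_pi sin_gt_zero)
  then have d: "Re d > 0" "Im d > 0" by (auto simp: d_def)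
  define B where "B = exp (- y * \<alpha>) * (C + 12 * exp 1 * Q * ln r * sqrt r)"
  have B: "norm (\<Phi> (of_real (real n + 1/2) * d) - \<Phi> (of_real \<epsilon> * d)) \<le> B"
    if "0 < \<epsilon>" "\<epsilon> < 1/2" for \<epsilon> n
    unfolding B_def C_def Q_def d_def \<alpha>_def L_def r_def x_def y_def
    by (rule ray_bound_lower[OF \<Phi>' _ \<open>Im w < 0\<close> _ _ that])
      (use x r2 in \<open>simp_all add: x_def r_def w\<close>)
  have "norm (riemann_aux c s) \<le> norm (zeta_chi s) * (B * sqrt r * exp (1 + 2 * y * \<alpha> - x * (L - 1)))"
    unfolding \<alpha>_def L_def r_def x_def y_def by (rule riemann_aux_le_zeta_chi[OF c s \<Phi> d B w])
  also have "\<dots> \<le> norm (zeta_chi s) * (2 * pi * exp 2 * (C + 12 * exp 1) * ln r)"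
  proof (intro mult_left_mono)
    define X where "X = exp (1 + y * \<alpha> - x * (L - 1))"
    have X0: "X > 0" by (simp add: X_def)
    have "y * \<alpha> \<le> 0" using \<open>Im w < 0\<close> \<alpha> by (auto simp: y_def mult_le_0_iff)
    moreover have "1 * (L - 1) \<le> x * (L - 1)" using x L1 by (intro mult_right_mono) auto
    ultimately have "X \<le> exp (2 - L)" by (simp add: X_def)
    also have e2: "exp (2 - L) = 2 * pi * exp 2 / r" using r0 by (simp add: exp_diff expL)
    finally have X1: "X * r \<le> 2 * pi * exp 2" using r0 by (simp add: le_divide_eq)
    have "0 \<le> (x - 1) * (L - 1)" using x L1 by (intro mult_nonneg_nonneg) auto
    moreover have "x * (L - 1) = (x - 1) * (L - 1) + (L - 1)" by (simp add: algebra_simps)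
    ultimately have "(x - 1) * (L - 1) / 2 - x * (L - 1) \<le> - (L - 1)" by argo
    with \<open>y * \<alpha> \<le> 0\<close> have "(x - 1) * (L - 1) / 2 + (1 + y * \<alpha> - x * (L - 1)) \<le> 2 - L" by linarith
    then have "Q * X \<le> exp (2 - L)" by (simp add: Q_def X_def flip: exp_add)
    then have X2: "Q * X * r \<le> 2 * pi * exp 2" unfolding e2 using r0 by (simp add: le_divide_eq)
    have "exp (- y * \<alpha>) * exp (1 + 2 * y * \<alpha> - x * (L - 1)) = X"
      by (simp add: X_def flip: exp_add)
    then have "B * sqrt r * exp (1 + 2 * y * \<alpha> - x * (L - 1)) = X * (C * sqrt r + 12 * exp 1 * Q * ln r * r)"
      using r0 by (simp add: B_def algebra_simps)
    also have "\<dots> = C * (X * sqrt r) + 12 * exp 1 * ln r * (Q * X * r)"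
      by (simp add: algebra_simps)
    also have "\<dots> \<le> C * (2 * pi * exp 2 * ln r) + 12 * exp 1 * ln r * (2 * pi * exp 2)"
    proof (intro add_mono mult_left_mono X2)
      have "sqrt r \<le> r" using r2 by (intro real_le_lsqrt) (auto simp: power2_eq_square)
      then have "X * sqrt r \<le> X * r" using X0 by simp
      also have "\<dots> \<le> 2 * pi * exp 2 * 1" using X1 by simp
      also have "\<dots> \<le> 2 * pi * exp 2 * ln r" using lnr by (intro mult_left_mono) auto
      finally show "X * sqrt r \<le> 2 * pi * exp 2 * ln r" .
    qed (use lnr in \<open>auto simp: C_def\<close>)
    also have "\<dots> = 2 * pi * exp 2 * (C + 12 * exp 1) * ln r" by (simp add: algebra_simps)
    finally show "B * sqrt r * exp (1 + 2 * y * \<alpha> - x * (L - 1)) \<le> 2 * pi * exp 2 * (C + 12 * exp 1) * ln r" .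
  qed auto
  finally show ?thesis by (simp add: C_def r_def)
qed

text \<open>The region gives y \<alpha> <= x sqrt L, a quarter of x (L - 1) at most, so half of x (L
  - 1) coming from the ray still leaves a negative total. With x >= 4 the exponent is at most 3 - L,
  and exp (- L) cancels both factors sqrt |w|.\<close>

lemma riemann_aux_bound_upper:
  assumes c: "0 < c" "c < 1" and s: "s \<in> region_G" "Re s < 0" and w: "w = 1 - s" and y: "0 \<le> Im w"
    and L: "25 \<le> ln (norm w / (2 * pi))"
  shows "norm (riemann_aux c s) \<le> norm (zeta_chi s) * (2 * pi * exp 3)"
proof -
  define \<alpha> where "\<alpha> = pi / 4 + arctan (Im w / Re w) / 2"
  define L where "L = ln (norm w / (2 * pi))"
  define r where "r = norm w"
  define x where "x = Re w"
  define y where "y = Im w"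
  define Q where "Q = exp ((x - 1) * (L - 1) / 2)"
  have x1: "1 \<le> x" using s by (simp add: x_def w)
  have r0: "r > 0" using x1 by (auto simp: r_def x_def)
  have L25: "25 \<le> L" using L by (simp add: L_def)
  have expL: "exp L = r / (2 * pi)" using r0 by (simp add: L_def r_def)
  have slope: "y \<le> x * (sqrt L / 2)"
    using region_G_slope[OF s w] by (simp add: x_def y_def L_def)
  have y0: "0 \<le> y" using \<open>0 \<le> Im w\<close> by (simp add: y_def)
  \<comment> \<open>Far out in this half of the region Re w cannot stay small: the slope bound gives
    r^2 <= x^2 (1 + L / 4) <= x^2 exp L = x^2 r / (2 pi), hence x^2 >= 2 pi r = 4 pi^2 exp
    L.\<close>
  have x4: "4 \<le> x"
  proof -
    have "y\<^sup>2 \<le> (x * (sqrt L / 2))\<^sup>2" using slope y0 by (intro power_mono)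
    also have "\<dots> = x\<^sup>2 * (L / 4)" using L25 by (simp add: power_mult_distrib power_divide)
    finally have "r\<^sup>2 \<le> x\<^sup>2 * (1 + L / 4)"
      by (simp add: r_def x_def y_def cmod_power2 distrib_left)
    also have "\<dots> \<le> x\<^sup>2 * exp L"
    proof (intro mult_left_mono)
      show "1 + L / 4 \<le> exp L" using exp_ge_add_one_self[of L] L25 by linarith
    qed auto
    finally have "r * (r * (2 * pi)) \<le> r * x\<^sup>2"
      unfolding expL by (simp add: power2_eq_square field_simps)
    then have "r * (2 * pi) \<le> x\<^sup>2" using r0 by simp
    then have "exp L * (2 * pi) * (2 * pi) \<le> x\<^sup>2" by (simp add: expL)
    moreover have "16 \<le> exp L * (2 * pi) * (2 * pi)"
    proof -
      have "16 \<le> exp L" using exp_ge_add_one_self[of L] L25 by linarith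
      then have "16 * 1 * 1 \<le> exp L * (2 * pi) * (2 * pi)"
        using pi_gt3 by (intro mult_mono mult_nonneg_nonneg) linarith+
      then show ?thesis by simp
    qed
    ultimately have "16 \<le> x\<^sup>2" by (rule order_trans[rotated])
    then have "4\<^sup>2 \<le> x\<^sup>2" by simp
    then show ?thesis by (rule power2_le_imp_le) (use x1 in simp)
  qed
  obtain \<Phi> where \<Phi>: "\<And>u. u \<in> slit_strip \<Longrightarrow> (\<Phi> has_field_derivative riemann_aux_integrand s u) (at u)"
    using integrand_primitive[of s] by blast
  have \<Phi>': "(\<Phi> has_field_derivative riemann_aux_integrand s u) (at u)" if "Im u > 0" for u
    using that by (intro \<Phi>) (simp add: slit_strip_def)
  have \<alpha>: "0 < \<alpha>" "\<alpha> < pi / 2" using saddle_angle_bounds[of w] by (auto simp: \<alpha>_def)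
  define d where "d = cis \<alpha>"
  have d: "Re d > 0" "Im d > 0" unfolding d_def using \<alpha> by (auto intro!: cos_gt_zero_pi sin_gt_zero)
  define B where "B = exp (- y * \<alpha>) * Q * exp 1 * sqrt r"
  have B: "norm (\<Phi> (of_real (real n + 1/2) * d) - \<Phi> (of_real \<epsilon> * d)) \<le> B"
    if "0 < \<epsilon>" "\<epsilon> < 1/2" for \<epsilon> n
    unfolding B_def Q_def d_def \<alpha>_def L_def r_def x_def y_def
    by (rule ray_bound_upper[OF \<Phi>' _ \<open>0 \<le> Im w\<close>])
      (use x4 L25 that in \<open>simp_all add: x_def L_def w\<close>)
  have "norm (riemann_aux c s) \<le> norm (zeta_chi s) * (B * sqrt r * exp (1 + 2 * y * \<alpha> - x * (L - 1)))"
    unfolding \<alpha>_def L_def r_def x_def y_def by (rule riemann_aux_le_zeta_chi[OF c s(2) \<Phi> d B w])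
  also have "\<dots> \<le> norm (zeta_chi s) * (2 * pi * exp 3)"
  proof (intro mult_left_mono)
    have "\<alpha> \<le> 2" using \<alpha> pi_less_4 by linarith
    then have "y * \<alpha> \<le> x * (sqrt L / 2) * 2" using slope y0 x1 L25 \<alpha> by (intro mult_mono) auto
    also have "\<dots> = x * sqrt L" by simp
    \<comment> \<open>This is where 25 comes from: sqrt L >= 5 gives 5 sqrt L <= L, hence 4 sqrt L
      <= L - 1.\<close>
    also have "\<dots> \<le> x * ((L - 1) / 4)"
    proof (intro mult_left_mono)
      have q: "5 \<le> sqrt L" using L25 by (intro real_le_rsqrt) auto
      have "5 * sqrt L \<le> sqrt L * sqrt L" using q L25 by (intro mult_right_mono) auto
      also have "sqrt L * sqrt L = L" using L25 by simp
      finally have "5 * sqrt L \<le> L" .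
      then show "sqrt L \<le> (L - 1) / 4" using q by simp
    qed (use x1 in auto)
    finally have "y * \<alpha> \<le> x * (L - 1) / 4" by simp
    moreover have "4 * (L - 1) \<le> x * (L - 1)" using x4 L25 by (intro mult_right_mono) auto
    moreover have "(x - 1) * (L - 1) / 2 = x * (L - 1) / 2 - (L - 1) / 2"
      by (simp add: left_diff_distrib diff_divide_distrib)
    moreover have "2 + a + m - p \<le> 2 - l"
      if "a \<le> p / 4" "4 * l \<le> p" "m = p / 2 - l / 2" "0 \<le> l" for a p l m :: real
      using that by argo
    moreover have "0 \<le> L - 1" using L25 by simp
    ultimately have "2 + y * \<alpha> + (x - 1) * (L - 1) / 2 - x * (L - 1) \<le> 2 - (L - 1)"
      by blast
    then have "2 + y * \<alpha> + (x - 1) * (L - 1) / 2 - x * (L - 1) \<le> 3 - L" by linarith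
    then have "exp (2 + y * \<alpha> + (x - 1) * (L - 1) / 2 - x * (L - 1)) \<le> exp (3 - L)" by simp
    also have "exp (3 - L) = 2 * pi * exp 3 / r" using r0 by (simp add: exp_diff expL)
    finally have "exp (2 + y * \<alpha> + (x - 1) * (L - 1) / 2 - x * (L - 1)) * r \<le> 2 * pi * exp 3"
      using r0 by (simp add: le_divide_eq)
    moreover have "exp (- y * \<alpha>) * Q * exp 1 * exp (1 + 2 * y * \<alpha> - x * (L - 1)) =
        exp (2 + y * \<alpha> + (x - 1) * (L - 1) / 2 - x * (L - 1))"
      unfolding Q_def exp_add[symmetric] by (rule arg_cong[of _ _ exp]) simp
    moreover have "B * sqrt r * exp (1 + 2 * y * \<alpha> - x * (L - 1)) =
        exp (- y * \<alpha>) * Q * exp 1 * exp (1 + 2 * y * \<alpha> - x * (L - 1)) * r"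
      using r0 by (simp add: B_def)
    ultimately show "B * sqrt r * exp (1 + 2 * y * \<alpha> - x * (L - 1)) \<le> 2 * pi * exp 3" by simp
  qed auto
  finally show ?thesis .
qed

text \<open>The sign of Im w selects one of the two bounds. The bounded quotient of the upper half
  is absorbed in ln |w| >= 1, and the resulting constant does not depend on
  \<open>c\<close>.\<close>

theorem corollary24:
  fixes c :: real
  assumes "0 < c" and "c < 1"
  shows "riemann_aux c \<in> O[inf at_infinity (principal {s \<in> region_G. Re s < 0})](\<lambda>s.
           zeta_chi s * of_real (ln (cmod s)))"
proof -
  define K where "K = 2 * pi * exp 2 * (pi * exp pi + 1 + 12 * exp (1::real))"
  have K0: "K \<ge> 0" by (simp add: K_def)
  have K3: "2 * pi * exp 3 \<le> K"
  proof -
    have "exp 3 = exp 2 * exp (1::real)" by (simp flip: exp_add)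
    moreover have "2 * pi * exp 2 * exp 1 \<le> 2 * pi * exp 2 * (pi * exp pi + 1 + 12 * exp (1::real))"
      by (intro mult_left_mono) (auto intro: add_increasing)
    ultimately show ?thesis by (simp add: K_def mult.assoc)
  qed
  \<comment> \<open>The threshold ensures |w| >= 2 pi exp 25, that is L >= 25, for w = 1 - s. The
    factor 2 pays for replacing ln |w| by ln |s|.\<close>
  have "norm (riemann_aux c s) \<le> 2 * K * norm (zeta_chi s * of_real (ln (cmod s)))"
    if s: "s \<in> region_G" "Re s < 0" "2 * pi * exp 25 + 1 \<le> norm s" for s
  proof -
    define w where "w = 1 - s"
    have "norm s \<le> norm w + 1" using norm_triangle_ineq4[of 1 w] by (simp add: w_def)
    then have r: "2 * pi * exp 25 \<le> norm w" using s by simp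
    then have "exp 25 \<le> norm w / (2 * pi)" by (simp add: le_divide_eq mult_ac)
    moreover have "w \<noteq> 0" using s by (auto simp: w_def)
    then have "0 < norm w / (2 * pi)" by simp
    ultimately have L: "25 \<le> ln (norm w / (2 * pi))" by (simp add: ln_ge_iff)
    have e: "1 * 3 \<le> 2 * pi * exp (25::real)"
      using pi_gt3 exp_ge_add_one_self[of 25] by (intro mult_mono) auto
    then have s2: "norm s \<ge> 2" "norm w \<ge> 3" using s r by linarith+
    have lnr: "1 \<le> ln (norm w)"
    proof -
      have "exp 1 \<le> norm w" using exp_le s2 by linarith
      then show ?thesis using s2 by (subst ln_ge_iff) auto
    qed
    have "norm w \<le> norm s + 1" using norm_triangle_ineq4[of 1 s] by (simp add: w_def)
    also have "\<dots> \<le> norm s * 2" using s2 by simp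
    also have "\<dots> \<le> norm s * norm s" using s2 by (intro mult_left_mono) auto
    finally have "ln (norm w) \<le> ln (norm s * norm s)" using s2 by (subst ln_le_cancel_iff) auto
    moreover have "s \<noteq> 0" using s2 by auto
    ultimately have lns: "ln (norm w) \<le> 2 * ln (norm s)" by (simp add: ln_mult)
    have "norm (riemann_aux c s) \<le> norm (zeta_chi s) * (K * ln (norm w))"
    proof (cases "Im w < 0")
      case True
      then show ?thesis
        using riemann_aux_bound_lower[OF assms s(2) w_def] L by (simp add: K_def)
    next
      case False
      then have "norm (riemann_aux c s) \<le> norm (zeta_chi s) * (2 * pi * exp 3)"
        using riemann_aux_bound_upper[OF assms s(1,2) w_def] L by simp
      also have "\<dots> \<le> norm (zeta_chi s) * (K * ln (norm w))"
        using K3 K0 lnr mult_mono[of "2 * pi * exp 3" K 1 "ln (norm w)"] by (intro mult_left_mono) auto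
      finally show ?thesis .
    qed
    also have "\<dots> \<le> norm (zeta_chi s) * (K * (2 * ln (norm s)))"
      using lns K0 by (intro mult_left_mono) auto
    also have "\<dots> = 2 * K * norm (zeta_chi s * of_real (ln (cmod s)))"
      using s2 by (simp add: norm_mult)
    finally show ?thesis .
  qed
  then show ?thesis
    by (intro landau_o.bigI[of "2 * K + 1"] bigoI[of _ "2 * K"])
      (auto simp: eventually_inf_principal eventually_at_infinity)
qed

end
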